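(* Let $X$ be a (real or complex) Banach space, let $F : X \to X$ be a $C^1$ diffeomorphism, and let $p$ be a generalized hyperbolic fixed point of $F$. Then $F$ is topologically conjugated to $DF_p$ near $p$; that is, there exist a homeomorphism $H : X \to X$ and an open neighborhood $U$ of $p$ in $X$ such that $$H \circ F = DF_p \circ H \quad \text{on } U.$$ Moreover, for $\theta > 0$ small enough (i.e., there is $\theta_0 > 0$ such that for every $\theta \in (0,\theta_0)$), an open neighborhood $U$ of $p$ in $X$ and a homeomorphism $H : X \to X$ satisfying $H \circ F = DF_p \circ H$ on $U$ can be chosen so that, in addition, $H : U \to H(U)$ is a $\theta$-Hölder homeomorphism.
   Context: $DF_p$ denotes the derivative of $F$ at $p$, $\mathbb{D}$ the open unit disc in the complex plane, and $\sigma(\cdot)$ the spectrum of a bounded linear operator (in the case of real Banach spaces, the spectrum of its complexification). A fixed point $p$ of $F$ is called a generalized hyperbolic fixed point of $F$ if $DF_p$ is a generalized hyperbolic operator on $X$, that is, $DF_p$ is an invertible bounded linear operator on $X$ and there is a splitting $X = E_p^- \oplus E_p^+$, where $E_p^-$ and $E_p^+$ are closed subspaces of $X$ with $DF_p(E_p^+) \subset E_p^+$, $(DF_p)^{-1}(E_p^-) \subset E_p^-$, $\sigma(DF_p|_{E_p^+}) \subset \mathbb{D}$ and $\sigma((DF_p)^{-1}|_{E_p^-}) \subset \mathbb{D}$. Here $DF_p|_{E_p^+}$ and $(DF_p)^{-1}|_{E_p^-}$ are regarded as bounded linear operators on $E_p^+$ and on $E_p^-$, respectively. (The inclusions may be strict.)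 For open subsets $U, V$ of $X$ and $\theta > 0$, a homeomorphism $H : U \to V$ is said to be $\theta$-Hölder if there is a constant $c > 0$ such that $\|H(x) - H(x')\| \leq c\,\|x - x'\|^\theta$ for all $x, x' \in U$ and $\|H^{-1}(y) - H^{-1}(y')\| \leq c\,\|y - y'\|^\theta$ for all $y, y' \in V$. *)

theory Defs
  imports "HOL-Analysis.Analysis"
begin

(* The complex Banach spaces are the real ones (class banach) together with a complex scalar
   multiplication that extends scaleR and for which the norm is homogeneous. *)
locale complex_banach_space = vector_space scaleC
  for scaleC :: "complex \<Rightarrow> 'a::banach \<Rightarrow> 'a" +
  assumes scaleC_of_real: "scaleC (complex_of_real r) x = r *\<^sub>R x"
    and norm_scaleC: "norm (scaleC c x) = cmod c * norm x"

(* Below, s is the scalar multiplication: scaleR in the real case, scaleC in the complex case.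
   A Frechet derivative over the complex numbers is a real one that is complex linear. *)
definition C1_map :: "('k::field \<Rightarrow> 'a::real_normed_vector \<Rightarrow> 'a) \<Rightarrow> ('a \<Rightarrow> 'a) \<Rightarrow> bool" where
  "C1_map s F \<longleftrightarrow>
     (\<exists>F' :: 'a \<Rightarrow> 'a \<Rightarrow>\<^sub>L 'a.
        (\<forall>x. (F has_derivative blinfun_apply (F' x)) (at x) \<and>
             Vector_Spaces.linear s s (blinfun_apply (F' x))) \<and>
        continuous_on UNIV F')"

definition C1_diffeomorphism ::
    "('k::field \<Rightarrow> 'a::real_normed_vector \<Rightarrow> 'a) \<Rightarrow> ('a \<Rightarrow> 'a) \<Rightarrow> bool" where
  "C1_diffeomorphism s F \<longleftrightarrow> bij F \<and> C1_map s F \<and> C1_map s (inv F)"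

definition bounded_operator_on ::
    "('k::field \<Rightarrow> 'a::real_normed_vector \<Rightarrow> 'a) \<Rightarrow> 'a set \<Rightarrow> ('a \<Rightarrow> 'a) \<Rightarrow> bool" where
  "bounded_operator_on s E T \<longleftrightarrow>
     T ` E \<subseteq> E \<and>
     (\<forall>x\<in>E. \<forall>y\<in>E. T (x + y) = T x + T y) \<and>
     (\<forall>c. \<forall>x\<in>E. T (s c x) = s c (T x)) \<and>
     (\<exists>K. \<forall>x\<in>E. norm (T x) \<le> K * norm x)"

(* Spectrum of the restriction of T to E, as an operator on E; meaningful if E is a subspace and
   T maps E into E. *)
definition spectrum_on ::
    "(complex \<Rightarrow> 'a::real_normed_vector \<Rightarrow> 'a) \<Rightarrow> 'a set \<Rightarrow> ('a \<Rightarrow> 'a) \<Rightarrow> complex set" where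
  "spectrum_on s E T =
     {z. \<not> (\<exists>R. bounded_operator_on s E R \<and>
               (\<forall>x\<in>E. R (T x - s z x) = x \<and> T (R x) - s z (R x) = x))}"

(* The complexification of a real space is realised on pairs, (x, y) standing for x + i y.
   The norm of the product type is only equivalent to a complex norm on it, but boundedness of
   operators, and hence the spectrum, does not depend on the choice of an equivalent norm. *)
definition complexification_scale ::
    "complex \<Rightarrow> 'a::real_vector \<times> 'a \<Rightarrow> 'a \<times> 'a" where
  "complexification_scale z = (\<lambda>(x, y).
     (Re z *\<^sub>R x - Im z *\<^sub>R y, Re z *\<^sub>R y + Im z *\<^sub>R x))"

definition real_spectrum_on :: "'a::real_normed_vector set \<Rightarrow> ('a \<Rightarrow> 'a) \<Rightarrow> complex set" where
  "real_spectrum_on E T = spectrum_on complexification_scale (E \<times> E) (map_prod T T)"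

lemma vector_space_complexification_scale: "vector_space complexification_scale"
  by unfold_locales (auto simp: complexification_scale_def algebra_simps)

(* spec E T is the spectrum of T as an operator on E: real_spectrum_on in the real case,
   spectrum_on scaleC in the complex case. *)
definition generalized_hyperbolic ::
    "('k::field \<Rightarrow> 'a::real_normed_vector \<Rightarrow> 'a) \<Rightarrow> ('a set \<Rightarrow> ('a \<Rightarrow> 'a) \<Rightarrow> complex set) \<Rightarrow>
     ('a \<Rightarrow> 'a) \<Rightarrow> bool" where
  "generalized_hyperbolic s spec T \<longleftrightarrow>
     bounded_linear T \<and> Vector_Spaces.linear s s T \<and> bij T \<and> bounded_linear (inv T) \<and>
     (\<exists>Em Ep. module.subspace s Em \<and> closed Em \<and> module.subspace s Ep \<and> closed Ep \<and>
        Em \<inter> Ep = {0} \<and> (\<forall>x. \<exists>u\<in>Em. \<exists>v\<in>Ep. x = u + v) \<and>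
        T ` Ep \<subseteq> Ep \<and> inv T ` Em \<subseteq> Em \<and>
        spec Ep T \<subseteq> ball 0 1 \<and> spec Em (inv T) \<subseteq> ball 0 1)"

definition generalized_hyperbolic_fixed_point ::
    "('k::field \<Rightarrow> 'a::real_normed_vector \<Rightarrow> 'a) \<Rightarrow> ('a set \<Rightarrow> ('a \<Rightarrow> 'a) \<Rightarrow> complex set) \<Rightarrow>
     ('a \<Rightarrow> 'a) \<Rightarrow> 'a \<Rightarrow> bool" where
  "generalized_hyperbolic_fixed_point s spec F p \<longleftrightarrow>
     F p = p \<and> generalized_hyperbolic s spec (frechet_derivative F (at p))"

definition holder_homeomorphism ::
    "real \<Rightarrow> 'a::real_normed_vector set \<Rightarrow> 'a set \<Rightarrow> ('a \<Rightarrow> 'a) \<Rightarrow> bool" where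
  "holder_homeomorphism \<theta> U V H \<longleftrightarrow>
     open U \<and> open V \<and> homeomorphism U V H (inv_into U H) \<and>
     (\<exists>c>0.
        (\<forall>x\<in>U. \<forall>x'\<in>U. norm (H x - H x') \<le> c * norm (x - x') powr \<theta>) \<and>
        (\<forall>y\<in>V. \<forall>y'\<in>V. norm (inv_into U H y - inv_into U H y') \<le> c * norm (y - y') powr \<theta>))"

end

theory Submission
  imports Defs
begin

text \<open>
Write \<open>T\<close> for the derivative of \<open>F\<close> at \<open>p\<close>. Near \<open>p\<close>, the map \<open>F\<close> is \<open>T\<close> plus a remainder whose
Lipschitz constant tends to zero with the size of the neighbourhood. Composing the remainder with a
radial retraction makes it global: \<open>F\<close> agrees near \<open>p\<close> with \<open>G = T + f\<close>, where \<open>f\<close> is bounded and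
Lipschitz with a small constant, so a global conjugacy between \<open>G\<close> and \<open>T\<close> suffices
(\<open>local_linearization\<close>).

The map \<open>H = id + h\<close> satisfies \<open>H \<circ> G = T \<circ> H\<close> exactly if \<open>h\<close> solves the linear equation
\<open>T h - h \<circ> G = f\<close>. Let \<open>P\<close> and \<open>Q\<close> be the projections onto the forward invariant summand and the
backward invariant one. Solving for the first component by iterating \<open>T\<close> and for the second by
iterating its inverse gives the series
\<open>L\<^sub>G f = (\<Sum>n. T\<^sup>-\<^sup>n\<^sup>-\<^sup>1 Q f G\<^sup>n) - (\<Sum>n. T\<^sup>n P f G\<^sup>-\<^sup>n\<^sup>-\<^sup>1)\<close>,
which converges geometrically. Since each summand is invariant in only one time direction, a bounded
solution need not be unique, and the usual proof that \<open>H\<close> is invertible, by uniqueness of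
semiconjugacies, breaks down. What replaces it is that the solution \<open>L\<^sub>G f\<close> is natural: if
\<open>G \<circ> K = K \<circ> T\<close>, then \<open>L\<^sub>G f \<circ> K = L\<^sub>T (f \<circ> K)\<close>.

Let \<open>k\<close> be the fixed point of the contraction \<open>k \<mapsto> - L\<^sub>T (f \<circ> (id + k))\<close>. Then \<open>K = id + k\<close> satisfies
\<open>G \<circ> K = K \<circ> T\<close>, and naturality gives \<open>h \<circ> K = L\<^sub>T (f \<circ> K) = - k\<close>, that is, \<open>H \<circ> K = id\<close>. Naturality
along \<open>H\<close> gives \<open>K \<circ> H - id = L\<^sub>G f - L\<^sub>G (f \<circ> K \<circ> H)\<close>; as \<open>f\<close> has a small Lipschitz constant, the
supremum of the left hand side is at most half of itself, so \<open>K \<circ> H = id\<close>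
(\<open>conjugacy_exists\<close>). If \<open>\<theta>\<close> is so small that the decay rate of the series beats the \<open>\<theta>\<close>-th power of the
Lipschitz constants of \<open>G\<close>, \<open>T\<close> and their inverses, then \<open>L\<^sub>G\<close> and \<open>L\<^sub>T\<close> preserve \<open>\<theta>\<close>-Hoelder continuity,
and the fixed point can be found among \<open>\<theta>\<close>-Hoelder maps.

Two facts from functional analysis turn generalized hyperbolicity into the estimates behind the series.
The projections of a closed splitting are bounded, by the Baire category theorem
(\<open>projection_of_closed_splitting\<close>). An operator with spectrum in the open unit disc has exponentially
decaying powers (\<open>spectrum_in_disc_imp_exponential_decay\<close>); the proof avoids vector valued holomorphic
functions by averaging resolvents over roots of unity.
\<close>

section \<open>Projections of a closed splitting\<close>

text \<open>
The first half of the open mapping argument: by Baire, the sums with a bounded \<open>E\<close>-component are dense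
in some ball, and scaling turns this into an approximate decomposition with relative error \<open>1 / 2\<close>.
\<close>
lemma approximate_decomposition_bounded:
  fixes E G :: "'a::banach set"
  assumes E: "subspace E" and G: "subspace G"
    and decomp: "\<And>x. \<exists>u\<in>E. \<exists>v\<in>G. x = u + v"
  shows "\<exists>C>0. \<forall>x. \<exists>u\<in>E. \<exists>v\<in>G. norm u \<le> C * norm x \<and> norm (x - (u + v)) \<le> norm x / 2"
proof -
  define D where "D n = {u + v |u v. u \<in> E \<and> v \<in> G \<and> norm u \<le> real n}" for n :: nat
  have "\<exists>n. x \<in> D n" for x
  proof -
    obtain u v where "u \<in> E" "v \<in> G" "x = u + v"
      using decomp by blast
    moreover obtain n where "norm u \<le> real n"
      using real_arch_simple by blast
    ultimately show ?thesis
      unfolding D_def by blast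
  qed
  then have cover: "\<Union> (range (\<lambda>n. closure (D n))) = UNIV"
    using closure_subset by blast
  have "\<exists>n. interior (closure (D n)) \<noteq> {}"
  proof (rule ccontr)
    assume "\<not> ?thesis"
    then have "euclidean interior_of \<Union> (range (\<lambda>n. closure (D n))) = {}"
      by (intro Baire_category_alt) (auto simp: completely_metrizable_space_euclidean)
    then show False
      unfolding cover by simp
  qed
  then obtain n a where "a \<in> interior (closure (D n))"
    by blast
  then obtain e where e: "e > 0" "ball a e \<subseteq> closure (D n)"
    unfolding mem_interior by blast
  \<comment> \<open>every small vector is a difference of two elements of the ball around \<open>a\<close>\<close>
  have small: "\<exists>u\<in>E. \<exists>v\<in>G. norm u \<le> 2 * real n \<and> norm (y - (u + v)) < d"
    if "norm y < e" "d > 0" for y d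
  proof -
    have "a + y \<in> closure (D n)" "a \<in> closure (D n)"
      using e that by (auto simp: dist_norm subset_iff)
    then obtain w1 w2 where w: "w1 \<in> D n" "dist w1 (a + y) < d / 2" "w2 \<in> D n" "dist w2 a < d / 2"
      using \<open>d > 0\<close> unfolding closure_approachable by (meson half_gt_zero)
    then obtain u1 v1 u2 v2 where uv: "w1 = u1 + v1" "w2 = u2 + v2" "u1 \<in> E" "u2 \<in> E"
        "v1 \<in> G" "v2 \<in> G" "norm u1 \<le> n" "norm u2 \<le> n"
      unfolding D_def by blast
    have "y - ((u1 - u2) + (v1 - v2)) = (w2 - a) - (w1 - (a + y))"
      unfolding uv by simp
    then have "norm (y - ((u1 - u2) + (v1 - v2))) \<le> norm (w2 - a) + norm (w1 - (a + y))"
      using norm_triangle_ineq4 by metis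
    also have "\<dots> < d"
      using w by (simp add: dist_norm)
    finally have "norm (y - ((u1 - u2) + (v1 - v2))) < d" .
    moreover have "norm (u1 - u2) \<le> 2 * real n"
      using norm_triangle_ineq4[of u1 u2] uv by linarith
    ultimately show ?thesis
      using uv subspace_diff[OF E] subspace_diff[OF G] by metis
  qed
  define C where "C = 4 * real n / e + 1"
  have "C > 0"
    using e by (simp add: C_def add_nonneg_pos)
  moreover have "\<exists>u\<in>E. \<exists>v\<in>G. norm u \<le> C * norm x \<and> norm (x - (u + v)) \<le> norm x / 2" for x
  proof (cases "x = 0")
    case True
    then show ?thesis
      using subspace_0[OF E] subspace_0[OF G] by (intro bexI[of _ 0]) auto
  next
    case False
    define t where "t = e / (2 * norm x)"
    have t: "t > 0"
      using e False by (simp add: t_def)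
    have "norm (t *\<^sub>R x) < e"
      using e False by (simp add: t_def)
    then obtain u v where uv: "u \<in> E" "v \<in> G" "norm u \<le> 2 * real n"
        "norm (t *\<^sub>R x - (u + v)) < e / 4"
      using small e by (metis zero_less_divide_iff zero_less_numeral)
    have "x - ((1 / t) *\<^sub>R u + (1 / t) *\<^sub>R v) = (1 / t) *\<^sub>R (t *\<^sub>R x - (u + v))"
      using t by (simp add: algebra_simps)
    then have "norm (x - ((1 / t) *\<^sub>R u + (1 / t) *\<^sub>R v)) = norm (t *\<^sub>R x - (u + v)) / t"
      using t by simp
    also have "\<dots> \<le> (e / 4) / t"
      using uv t by (intro divide_right_mono) auto
    also have "\<dots> = norm x / 2"
      using e False by (simp add: t_def)
    finally have 1: "norm (x - ((1 / t) *\<^sub>R u + (1 / t) *\<^sub>R v)) \<le> norm x / 2" .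
    have "norm ((1 / t) *\<^sub>R u) = norm u / t"
      using t by simp
    also have "\<dots> \<le> 2 * real n / t"
      using uv t by (intro divide_right_mono) auto
    also have "\<dots> \<le> C * norm x"
      using e False by (simp add: t_def C_def field_simps)
    finally have "norm ((1 / t) *\<^sub>R u) \<le> C * norm x" .
    with 1 show ?thesis
      using uv subspace_scale[OF E] subspace_scale[OF G] by metis
  qed
  ultimately show ?thesis
    by blast
qed

text \<open>
The second half of the open mapping argument: decompose approximately, then decompose the error, and so
on. The errors shrink geometrically, so the \<open>E\<close>-components form a convergent series; closedness keeps
both limits in their subspaces.
\<close>
lemma decomposition_bounded:
  fixes E G :: "'a::banach set"
  assumes E: "subspace E" "closed E" and G: "subspace G" "closed G"
    and decomp: "\<And>x. \<exists>u\<in>E. \<exists>v\<in>G. x = u + v"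
  shows "\<exists>C. \<forall>x. \<exists>u\<in>E. \<exists>v\<in>G. x = u + v \<and> norm u \<le> C * norm x"
proof -
  obtain C where C: "C > 0"
    "\<forall>x. \<exists>u\<in>E. \<exists>v\<in>G. norm u \<le> C * norm x \<and> norm (x - (u + v)) \<le> norm x / 2"
    using approximate_decomposition_bounded[OF E(1) G(1) decomp] by blast
  then obtain U where "\<forall>x. U x \<in> E \<and> (\<exists>v\<in>G. norm (U x) \<le> C * norm x \<and> norm (x - (U x + v)) \<le> norm x / 2)"
    by metis
  then obtain V where UV: "\<And>x. U x \<in> E" "\<And>x. V x \<in> G" "\<And>x. norm (U x) \<le> C * norm x"
      "\<And>x. norm (x - (U x + V x)) \<le> norm x / 2"
    by metis
  have "\<exists>u\<in>E. \<exists>v\<in>G. x = u + v \<and> norm u \<le> 2 * C * norm x" for x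
  proof -
    define e where "e n = ((\<lambda>y. y - (U y + V y)) ^^ n) x" for n
    have e_Suc: "e (Suc n) = e n - (U (e n) + V (e n))" for n
      by (simp add: e_def)
    have e_bound: "norm (e n) \<le> norm x * (1 / 2) ^ n" for n
    proof (induction n)
      case (Suc n)
      have "norm (e (Suc n)) \<le> norm (e n) / 2"
        unfolding e_Suc by (rule UV)
      then show ?case
        using Suc by simp
    qed (simp add: e_def)
    have sum_eq: "(\<Sum>i<n. V (e i)) = x - e n - (\<Sum>i<n. U (e i))" for n
      by (induction n) (auto simp: e_Suc, simp add: e_def)
    have U_bound: "norm (U (e n)) \<le> (C * norm x) * (1 / 2) ^ n" for n
      using order_trans[OF UV(3) mult_left_mono[OF e_bound]] C(1) by (simp add: mult.assoc)
    have geo: "summable (\<lambda>n. (C * norm x) * (1 / 2 :: real) ^ n)"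
      by (intro summable_mult summable_geometric) simp
    define u where "u = (\<Sum>n. U (e n))"
    have "summable (\<lambda>n. norm (U (e n)))"
      by (rule summable_comparison_test'[OF geo]) (use U_bound in simp)
    then have u: "(\<lambda>n. \<Sum>i<n. U (e i)) \<longlonglongrightarrow> u" "norm u \<le> (\<Sum>n. norm (U (e n)))"
      unfolding u_def
      by (auto intro!: summable_LIMSEQ summable_norm_cancel summable_norm)
    note u(2)
    also have "(\<Sum>n. norm (U (e n))) \<le> (\<Sum>n. (C * norm x) * (1 / 2) ^ n)"
      using \<open>summable (\<lambda>n. norm (U (e n)))\<close> geo U_bound by (intro suminf_le) auto
    also have "\<dots> = 2 * C * norm x"
      by (subst suminf_mult) (auto simp: suminf_geometric)
    finally have "norm u \<le> 2 * C * norm x" .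
    moreover have "u \<in> E"
      by (rule closed_sequentially[OF E(2) _ u(1)]) (intro subspace_sum[OF E(1)] UV)
    moreover have "x - u \<in> G"
    proof (rule closed_sequentially[OF G(2)])
      show "(\<Sum>i<n. V (e i)) \<in> G" for n
        by (intro subspace_sum[OF G(1)] UV)
      have "(\<lambda>n. norm x * (1 / 2) ^ n) \<longlonglongrightarrow> norm x * 0"
        by (intro tendsto_intros LIMSEQ_realpow_zero) auto
      then have "e \<longlonglongrightarrow> 0"
        using e_bound by (intro Lim_null_comparison[where f = e and g = "\<lambda>n. norm x * (1 / 2) ^ n"]) auto
      then have "(\<lambda>n. x - e n - (\<Sum>i<n. U (e i))) \<longlonglongrightarrow> x - 0 - u"
        by (intro tendsto_intros u)
      then show "(\<lambda>n. \<Sum>i<n. V (e i)) \<longlonglongrightarrow> x - u"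
        unfolding sum_eq by simp
    qed
    ultimately show ?thesis
      by (intro bexI[of _ u] bexI[of _ "x - u"]) auto
  qed
  then show ?thesis
    by blast
qed

lemma projection_of_closed_splitting:
  fixes E G :: "'a::banach set"
  assumes E: "subspace E" "closed E" and G: "subspace G" "closed G" and "E \<inter> G = {0}"
    and decomp: "\<And>x. \<exists>u\<in>E. \<exists>v\<in>G. x = u + v"
  obtains P where "bounded_linear P" "\<And>x. P x \<in> G" "\<And>x. x - P x \<in> E"
    "\<And>u v. u \<in> E \<Longrightarrow> v \<in> G \<Longrightarrow> P (u + v) = v"
proof -
  obtain C where "\<forall>x. \<exists>v\<in>G. \<exists>u\<in>E. x = v + u \<and> norm v \<le> C * norm x"
    using decomposition_bounded[OF G E] decomp by (metis add.commute)
  then obtain P where P: "\<And>x. P x \<in> G" "\<And>x. x - P x \<in> E" "\<And>x. norm (P x) \<le> C * norm x"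
    by (metis add_diff_cancel_left')
  have uniq: "P (u + v) = v" if "u \<in> E" "v \<in> G" for u v
  proof -
    have "P (u + v) - v \<in> G" "u - (u + v - P (u + v)) \<in> E"
      using that P subspace_diff E G by metis+
    then have "P (u + v) - v \<in> E \<inter> G"
      by (simp add: algebra_simps)
    then show ?thesis
      using \<open>E \<inter> G = {0}\<close> by simp
  qed
  have "bounded_linear P"
  proof (rule bounded_linear_intro)
    show "P (x + y) = P x + P y" for x y
      using uniq[OF subspace_add[OF E(1) P(2)[of x] P(2)[of y]]
          subspace_add[OF G(1) P(1)[of x] P(1)[of y]]]
      by (simp add: algebra_simps)
    show "P (r *\<^sub>R x) = r *\<^sub>R P x" for r x
      using uniq[OF subspace_scale[OF E(1) P(2)[of x]] subspace_scale[OF G(1) P(1)[of x]], of r r]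
      by (simp add: algebra_simps)
    show "norm (P x) \<le> norm x * C" for x
      using P(3) by (simp add: mult.commute)
  qed
  with P uniq show thesis
    using that by blast
qed

section \<open>Exponential decay from the spectrum\<close>

text \<open>
Once a sequence with \<open>b\<^sub>k\<^sub>+\<^sub>1 \<le> b\<^sub>k\<^sup>2\<close> has dropped to \<open>1 / 2\<close>, every further step at least halves it.
This is applied to norms of iterated squares of an operator.
\<close>
lemma null_of_square_bound:
  fixes b :: "nat \<Rightarrow> real"
  assumes nonneg: "\<And>k. 0 \<le> b k" and square: "\<And>k. b (Suc k) \<le> b k ^ 2" and small: "b k0 \<le> 1 / 2"
  shows "b \<longlonglongrightarrow> 0"
proof -
  have bound: "b (j + k0) \<le> (1 / 2) ^ Suc j" for j
  proof (induction j)
    case (Suc j)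
    have "(1 / 2 :: real) ^ Suc j \<le> 1 / 2"
      by (simp add: power_le_one)
    have "b (Suc j + k0) \<le> b (j + k0) * b (j + k0)"
      using square[of "j + k0"] by (simp add: power2_eq_square)
    also have "\<dots> \<le> (1 / 2) ^ Suc j * (1 / 2)"
      using Suc \<open>(1 / 2 :: real) ^ Suc j \<le> 1 / 2\<close> nonneg[of "j + k0"] by (intro mult_mono) linarith+
    finally show ?case
      by simp
  qed (use small in simp)
  have "(\<lambda>j. (1 / 2 :: real) ^ Suc j) \<longlonglongrightarrow> 0"
    by (intro LIMSEQ_Suc LIMSEQ_realpow_zero) auto
  then have "(\<lambda>j. b (j + k0)) \<longlonglongrightarrow> 0"
    by (rule Lim_null_comparison[rotated]) (use bound nonneg in simp)
  then show ?thesis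
    by (rule LIMSEQ_offset)
qed

text \<open>
The norm is homogeneous for complex scalars only up to the constant \<open>K\<close>, so that the complexification
of a real Banach space, with the norm of the product type, is covered as well.
\<close>
locale complex_linear_operator = vector_space s
  for s :: "complex \<Rightarrow> 'b::banach \<Rightarrow> 'b" +
  fixes K :: real and A :: "'b \<Rightarrow>\<^sub>L 'b"
  assumes s_of_real: "s (of_real r) x = r *\<^sub>R x"
    and norm_s: "norm (s z x) \<le> K * cmod z * norm x"
    and A_s: "A (s z x) = s z (A x)"
begin

definition scale_op :: "complex \<Rightarrow> 'b \<Rightarrow>\<^sub>L 'b" where
  "scale_op z = Blinfun (s z)"

text \<open>
This is \<open>(z A)\<close> raised to the power \<open>2\<^sup>k\<close>. Squaring alone suffices for the averaging argument below,
which then involves only averages of two resolvents at a time.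
\<close>
primrec sq_iterate :: "nat \<Rightarrow> complex \<Rightarrow> 'b \<Rightarrow>\<^sub>L 'b" where
  "sq_iterate 0 z = scale_op z o\<^sub>L A"
| "sq_iterate (Suc k) z = sq_iterate k z o\<^sub>L sq_iterate k z"

definition is_resolvent :: "nat \<Rightarrow> complex \<Rightarrow> ('b \<Rightarrow>\<^sub>L 'b) \<Rightarrow> bool" where
  "is_resolvent k z R \<longleftrightarrow> (\<forall>x. R (x - sq_iterate k z x) = x \<and> R x - sq_iterate k z (R x) = x)"

lemma s_scaleR: "s z (r *\<^sub>R x) = r *\<^sub>R s z x"
  by (metis s_of_real scale_left_commute)

lemma scale_op_apply [simp]: "scale_op z x = s z x"
proof -
  have "bounded_linear (s z)"
    using norm_s by (intro bounded_linear_intro[where K = "K * cmod z"])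
      (auto simp: scale_right_distrib s_scaleR mult.commute)
  then show ?thesis
    unfolding scale_op_def by (simp add: bounded_linear_Blinfun_apply)
qed

lemma norm_sq_iterate_Suc: "norm (sq_iterate (Suc k) z) \<le> norm (sq_iterate k z) ^ 2"
  by (simp add: norm_blinfun_compose power2_eq_square)

lemma sq_iterate_scale: "sq_iterate k z (s u x) = s u (sq_iterate k z x)"
  by (induction k arbitrary: x) (auto simp: A_s scale_left_commute)

lemma sq_iterate_mult: "sq_iterate k (u * z) x = s (u ^ 2 ^ k) (sq_iterate k z x)"
proof (induction k arbitrary: x)
  case (Suc k)
  have "(u ^ 2 ^ k) * (u ^ 2 ^ k) = u ^ 2 ^ Suc k"
    by (simp add: mult_2 power_add)
  then show ?case
    by (simp add: Suc sq_iterate_scale)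
qed auto

lemma sq_iterate_power: "sq_iterate k 1 x = (blinfun_apply A ^^ (2 ^ k)) x"
  by (induction k arbitrary: x) (auto simp: mult_2 funpow_add)

text \<open>
With \<open>B = (z A)\<close> raised to the power \<open>2\<^sup>k\<close>, the choice of \<open>\<zeta>\<close> turns \<open>B\<close> at \<open>\<zeta> z\<close> into \<open>- B\<close>, and the claim is
the partial fraction identity \<open>1 / (1 - B\<^sup>2) = (1 / (1 - B) + 1 / (1 + B)) / 2\<close>.
\<close>
lemma resolvent_square:
  assumes R: "is_resolvent k z R" and R': "is_resolvent k (\<zeta> * z) R'" and \<zeta>: "\<zeta> ^ 2 ^ k = -1"
  shows "is_resolvent (Suc k) z ((1 / 2) *\<^sub>R (R + R'))"
proof -
  define B where "B = sq_iterate k z"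
  have B': "sq_iterate k (\<zeta> * z) x = - B x" for x
    by (simp add: sq_iterate_mult \<zeta> B_def)
  have R1: "R (x - B x) = x" and R2: "B (R x) = R x - x" for x
    using R unfolding is_resolvent_def B_def by (auto simp: eq_diff_eq diff_eq_eq add.commute)
  have R1': "R' (x + B x) = x" and R2': "B (R' x) = x - R' x" for x
    using R' unfolding is_resolvent_def B' by (auto simp: eq_diff_eq add.commute)
  have "R (x - B (B x)) = x + B x" "R' (x - B (B x)) = x - B x" for x
    using R1[of "x + B x"] R1'[of "x - B x"] by (simp_all add: blinfun.bilinear_simps algebra_simps)
  then have 1: "(1 / 2) *\<^sub>R (R (x - B (B x)) + R' (x - B (B x))) = x" for x
    by (simp add: scaleR_2[symmetric])
  have "B (B (R x + R' x)) = (R x + R' x) - 2 *\<^sub>R x" for x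
    by (simp add: blinfun.bilinear_simps R2 R2' scaleR_2)
  then have "B (B ((1 / 2) *\<^sub>R (R x + R' x))) = (1 / 2) *\<^sub>R (R x + R' x) - x" for x
    by (simp add: blinfun.scaleR_right scaleR_diff_right)
  with 1 show ?thesis
    unfolding is_resolvent_def by (simp add: B_def[symmetric] blinfun.add_left blinfun.scaleR_left)
qed

text \<open>
The resolvent identity bounds the difference by the norm of the unknown resolvent \<open>R'\<close>; for close
parameters that norm is at most twice the norm of \<open>R\<close>.
\<close>
lemma norm_resolvent_diff:
  assumes R: "is_resolvent 0 z R" and R': "is_resolvent 0 w R'"
    and small: "K * norm A * norm R * dist w z \<le> 1 / 2" and K: "K \<ge> 0"
  shows "norm (R' - R) \<le> 2 * norm R * (K * norm A * norm R * dist w z)"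
proof -
  define q where "q = K * norm A * norm R * dist w z"
  have "0 \<le> q"
    using K by (simp add: q_def)
  have *: "norm (R' - R) \<le> norm R' * q"
  proof (rule norm_blinfun_bound)
    fix x
    have "R' x - R x = R' (R x - sq_iterate 0 z (R x)) - R' (R x - sq_iterate 0 w (R x))"
      using R R' unfolding is_resolvent_def by metis
    also have "\<dots> = R' (s (w - z) (A (R x)))"
      by (simp add: blinfun.bilinear_simps scale_left_diff_distrib)
    finally have "norm ((R' - R) x) \<le> norm R' * norm (s (w - z) (A (R x)))"
      by (simp add: blinfun.bilinear_simps norm_blinfun)
    also have "\<dots> \<le> norm R' * (K * dist w z * norm (A (R x)))"
      using norm_s by (intro mult_left_mono) (auto simp: dist_norm)
    also have "\<dots> \<le> norm R' * (K * dist w z * (norm A * (norm R * norm x)))"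
      using K by (intro mult_left_mono order_trans[OF norm_blinfun] norm_blinfun) auto
    finally show "norm ((R' - R) x) \<le> norm R' * q * norm x"
      by (simp add: q_def ac_simps)
  qed (use \<open>0 \<le> q\<close> in simp)
  have "norm R' \<le> norm R + norm (R' - R)"
    by (metis add_diff_cancel_left' norm_triangle_sub)
  also have "\<dots> \<le> norm R + norm R' * (1 / 2)"
    using * small[folded q_def] mult_left_mono[of q "1 / 2" "norm R'"] by simp
  finally have "norm R' * q \<le> 2 * norm R * q"
    using \<open>0 \<le> q\<close> by (intro mult_right_mono) auto
  with * show ?thesis
    unfolding q_def by linarith
qed

lemma resolvent_uniformly_continuous:
  assumes inv: "\<And>z. cmod z \<le> 1 \<Longrightarrow> \<exists>R. is_resolvent 0 z R" and K: "K \<ge> 0" and "\<epsilon> > 0"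
  shows "\<exists>\<delta>>0. \<exists>R. (\<forall>z. cmod z \<le> 1 \<longrightarrow> is_resolvent 0 z (R z)) \<and>
    (\<forall>z w. cmod z \<le> 1 \<longrightarrow> cmod w \<le> 1 \<longrightarrow> dist z w < \<delta> \<longrightarrow> norm (R z - R w) \<le> \<epsilon>)"
proof -
  obtain R where R: "\<And>z. cmod z \<le> 1 \<Longrightarrow> is_resolvent 0 z (R z)"
    using inv by metis
  have "continuous_on (cball 0 1) R"
    unfolding continuous_on_iff
  proof (intro ballI allI impI)
    fix z :: complex and e :: real
    assume z: "z \<in> cball 0 1" and "e > 0"
    define q where "q = K * norm A * norm (R z)"
    have "q \<ge> 0"
      using K by (simp add: q_def)
    define d where "d = min (1 / (2 * (q + 1))) (e / (2 * norm (R z) * q + 1))"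
    have "d > 0"
      using \<open>e > 0\<close> \<open>q \<ge> 0\<close> by (simp add: d_def add_nonneg_pos)
    moreover have "dist (R w) (R z) < e" if w: "w \<in> cball 0 1" "dist w z < d" for w
    proof -
      have "q * dist w z \<le> (q + 1) * (1 / (2 * (q + 1)))"
        using w \<open>q \<ge> 0\<close> by (intro mult_mono) (auto simp: d_def)
      also have "\<dots> = 1 / 2"
        using \<open>q \<ge> 0\<close> by (simp add: field_simps add_nonneg_eq_0_iff)
      finally have "q * dist w z \<le> 1 / 2" .
      then have "norm (R w - R z) \<le> 2 * norm (R z) * (q * dist w z)"
        using norm_resolvent_diff[OF R R] z w K unfolding q_def by simp
      also have "\<dots> \<le> (2 * norm (R z) * q + 1) * dist w z"
        by (simp add: algebra_simps)
      also have "\<dots> < (2 * norm (R z) * q + 1) * (e / (2 * norm (R z) * q + 1))"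
        using w \<open>q \<ge> 0\<close> by (intro mult_strict_left_mono) (auto simp: d_def add_nonneg_pos)
      also have "\<dots> = e"
        using \<open>q \<ge> 0\<close> by (simp add: add_nonneg_eq_0_iff)
      finally show ?thesis
        by (simp add: dist_norm)
    qed
    ultimately show "\<exists>d>0. \<forall>w\<in>cball 0 1. dist w z < d \<longrightarrow> dist (R w) (R z) < e"
      by blast
  qed
  then have "uniformly_continuous_on (cball 0 1) R"
    by (intro compact_uniformly_continuous) auto
  then obtain \<delta> where "\<delta> > 0"
    "\<And>z w. z \<in> cball 0 1 \<Longrightarrow> w \<in> cball 0 1 \<Longrightarrow> dist w z < \<delta> \<Longrightarrow> dist (R w) (R z) < \<epsilon>"
    using \<open>\<epsilon> > 0\<close> unfolding uniformly_continuous_on_def by meson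
  then show ?thesis
    using R by (intro exI[of _ \<delta>] exI[of _ R] conjI) (auto simp: dist_norm intro: less_imp_le)
qed

text \<open>
Averaging two functions with a common modulus of continuity, one of them composed with a rotation of
the disc, preserves the modulus. Hence the resolvents of all iterated squares inherit one modulus from
the uniformly continuous resolvent of \<open>A\<close> itself. This uniformity in \<open>k\<close> carries the decay of
\<open>(z A)\<close> to the powers \<open>2\<^sup>k\<close> from \<open>z = 0\<close> to \<open>z = 1\<close>.
\<close>
lemma resolvents_equicontinuous:
  assumes inv: "\<And>z. cmod z \<le> 1 \<Longrightarrow> \<exists>R. is_resolvent 0 z R" and K: "K \<ge> 0" and "\<epsilon> > 0"
  shows "\<exists>\<delta>>0. \<forall>k. \<exists>R. (\<forall>z. cmod z \<le> 1 \<longrightarrow> is_resolvent k z (R z)) \<and>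
    (\<forall>z w. cmod z \<le> 1 \<longrightarrow> cmod w \<le> 1 \<longrightarrow> dist z w < \<delta> \<longrightarrow> norm (R z - R w) \<le> \<epsilon>)"
proof -
  obtain \<delta> where "\<delta> > 0" and base: "\<exists>R. (\<forall>z. cmod z \<le> 1 \<longrightarrow> is_resolvent 0 z (R z)) \<and>
    (\<forall>z w. cmod z \<le> 1 \<longrightarrow> cmod w \<le> 1 \<longrightarrow> dist z w < \<delta> \<longrightarrow> norm (R z - R w) \<le> \<epsilon>)"
    using resolvent_uniformly_continuous[OF assms] by blast
  have "\<exists>R. (\<forall>z. cmod z \<le> 1 \<longrightarrow> is_resolvent k z (R z)) \<and>
    (\<forall>z w. cmod z \<le> 1 \<longrightarrow> cmod w \<le> 1 \<longrightarrow> dist z w < \<delta> \<longrightarrow> norm (R z - R w) \<le> \<epsilon>)" for k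
  proof (induction k)
    case (Suc k)
    then obtain R where R: "\<And>z. cmod z \<le> 1 \<Longrightarrow> is_resolvent k z (R z)"
      "\<And>z w. cmod z \<le> 1 \<Longrightarrow> cmod w \<le> 1 \<Longrightarrow> dist z w < \<delta> \<Longrightarrow> norm (R z - R w) \<le> \<epsilon>"
      by blast
    define \<zeta> where "\<zeta> = cis (pi / 2 ^ k)"
    have "\<zeta> ^ 2 ^ k = cis (real (2 ^ k) * (pi / 2 ^ k))"
      unfolding \<zeta>_def by (rule Complex.DeMoivre)
    then have \<zeta>: "\<zeta> ^ 2 ^ k = -1" "cmod \<zeta> = 1"
      by (simp_all add: \<zeta>_def)
    have "norm ((1 / 2) *\<^sub>R (R z + R (\<zeta> * z)) - (1 / 2) *\<^sub>R (R w + R (\<zeta> * w))) \<le> \<epsilon>"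
      if "cmod z \<le> 1" "cmod w \<le> 1" "dist z w < \<delta>" for z w
    proof -
      have "dist (\<zeta> * z) (\<zeta> * w) = dist z w"
        using \<zeta> by (simp add: dist_norm right_diff_distrib[symmetric] norm_mult)
      then have "norm (R z - R w) \<le> \<epsilon>" "norm (R (\<zeta> * z) - R (\<zeta> * w)) \<le> \<epsilon>"
        using R(2) that \<zeta> by (simp_all add: norm_mult)
      moreover have "(1 / 2) *\<^sub>R (R z + R (\<zeta> * z)) - (1 / 2) *\<^sub>R (R w + R (\<zeta> * w)) =
          (1 / 2) *\<^sub>R ((R z - R w) + (R (\<zeta> * z) - R (\<zeta> * w)))"
        by (simp add: algebra_simps)
      ultimately show ?thesis
        using norm_triangle_ineq[of "R z - R w" "R (\<zeta> * z) - R (\<zeta> * w)"] by simp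
    qed
    moreover have "is_resolvent (Suc k) z ((1 / 2) *\<^sub>R (R z + R (\<zeta> * z)))" if "cmod z \<le> 1" for z
      using that \<zeta> R(1)[of z] R(1)[of "\<zeta> * z"] by (intro resolvent_square) (auto simp: norm_mult)
    ultimately show ?case
      by (intro exI[of _ "\<lambda>z. (1 / 2) *\<^sub>R (R z + R (\<zeta> * z))"]) blast
  qed (rule base)
  with \<open>\<delta> > 0\<close> show ?thesis
    by blast
qed

lemma resolvent_near_id:
  assumes R: "is_resolvent k z R" and small: "norm (sq_iterate k z) \<le> 1 / 10"
  shows "norm (R - id_blinfun) \<le> 1 / 9"
proof -
  have "R x - x = sq_iterate k z (R x)" for x
    using R unfolding is_resolvent_def by (simp add: diff_eq_eq add.commute)
  then have R_eq: "R - id_blinfun = sq_iterate k z o\<^sub>L R"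
    by (intro blinfun_eqI) (simp add: blinfun.diff_left)
  have "norm (sq_iterate k z o\<^sub>L R) \<le> (1 / 10) * norm R"
    using norm_blinfun_compose[of "sq_iterate k z" R] mult_right_mono[OF small norm_ge_zero[of R]] by linarith
  moreover have "norm R \<le> 1 + norm (R - id_blinfun)"
    using norm_triangle_sub[of R id_blinfun] norm_blinfun_id_le[where ?'a = 'b] by linarith
  ultimately show ?thesis
    unfolding R_eq by linarith
qed

lemma small_of_resolvent_near_id:
  assumes R: "is_resolvent k z R" and near: "norm (R - id_blinfun) \<le> 1 / 3"
  shows "norm (sq_iterate k z) \<le> 1 / 2"
proof (rule norm_blinfun_bound)
  fix x
  let ?y = "x - sq_iterate k z x"
  have "sq_iterate k z x = (R - id_blinfun) ?y"
    using R unfolding is_resolvent_def by (simp add: blinfun.diff_left)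
  then have "norm (sq_iterate k z x) \<le> norm (R - id_blinfun) * norm ?y"
    by (metis norm_blinfun)
  also have "\<dots> \<le> (1 / 3) * (norm x + norm (sq_iterate k z x))"
    using near by (intro mult_mono norm_triangle_ineq4) auto
  finally show "norm (sq_iterate k z x) \<le> 1 / 2 * norm x"
    by simp
qed simp

text \<open>
If the powers of \<open>w A\<close> tend to zero, then their resolvents tend to the identity; by equicontinuity the
resolvents at a nearby \<open>z\<close> are close to the identity, which forces some iterated square of \<open>z A\<close> to have
norm at most \<open>1 / 2\<close>, so these also tend to zero. Finitely many steps of fixed length
along the real segment lead from \<open>0\<close> to \<open>1\<close>.
\<close>
lemma power_contraction:
  assumes inv: "\<And>z. cmod z \<le> 1 \<Longrightarrow> \<exists>R. is_resolvent 0 z R" and K: "K \<ge> 0"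
  shows "\<exists>n>0. \<forall>x. norm ((blinfun_apply A ^^ n) x) \<le> norm x / 2"
proof -
  obtain \<delta> where "\<delta> > 0" and eq: "\<And>k. \<exists>R. (\<forall>z. cmod z \<le> 1 \<longrightarrow> is_resolvent k z (R z)) \<and>
    (\<forall>z w. cmod z \<le> 1 \<longrightarrow> cmod w \<le> 1 \<longrightarrow> dist z w < \<delta> \<longrightarrow> norm (R z - R w) \<le> 1 / 9)"
    using resolvents_equicontinuous[OF assms, of "1 / 9"] by auto
  have step: "(\<lambda>k. norm (sq_iterate k z)) \<longlonglongrightarrow> 0"
    if zw: "cmod z \<le> 1" "cmod w \<le> 1" "dist z w < \<delta>" and null: "(\<lambda>k. norm (sq_iterate k w)) \<longlonglongrightarrow> 0" for z w
  proof -
    have "eventually (\<lambda>k. norm (sq_iterate k w) < 1 / 10) sequentially"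
      using null by (rule order_tendstoD) simp
    then obtain k where k: "norm (sq_iterate k w) < 1 / 10"
      by (auto simp: eventually_sequentially)
    obtain R where R: "\<And>z. cmod z \<le> 1 \<Longrightarrow> is_resolvent k z (R z)" and "norm (R z - R w) \<le> 1 / 9"
      using eq[of k] zw by blast
    moreover have "norm (R w - id_blinfun) \<le> 1 / 9"
      using resolvent_near_id[OF R] zw k by simp
    ultimately have "norm (R z - id_blinfun) \<le> 1 / 3"
      using norm_triangle_ineq[of "R z - R w" "R w - id_blinfun"] by simp
    then have "norm (sq_iterate k z) \<le> 1 / 2"
      using small_of_resolvent_near_id[OF R] zw by blast
    then show ?thesis
      by (rule null_of_square_bound[rotated 2]) (auto intro: norm_sq_iterate_Suc[simplified])
  qed
  obtain N where N: "inverse (real (Suc N)) < \<delta>"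
    using reals_Archimedean[OF \<open>\<delta> > 0\<close>] by blast
  have chain: "j \<le> Suc N \<Longrightarrow> (\<lambda>k. norm (sq_iterate k (of_real (j / Suc N)))) \<longlonglongrightarrow> 0" for j
  proof (induction j)
    case 0
    have "sq_iterate 0 0 = 0"
      by (intro blinfun_eqI) simp
    then show ?case
      by (intro null_of_square_bound[of _ 0]) (auto intro: norm_sq_iterate_Suc[simplified])
  next
    case (Suc j)
    let ?z = "complex_of_real (real (Suc j) / Suc N)" and ?w = "complex_of_real (real j / Suc N)"
    have "?z - ?w = of_real (inverse (Suc N))"
      unfolding of_real_diff[symmetric] by (simp add: field_simps)
    then have "dist ?z ?w = inverse (Suc N)"
      unfolding dist_norm by (simp only: norm_of_real) simp
    moreover have "cmod ?z \<le> 1" "cmod ?w \<le> 1"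
      using Suc.prems unfolding norm_of_real by (simp_all add: field_simps)
    ultimately show ?case
      using Suc N by (intro step[of ?z ?w]) auto
  qed
  have "(\<lambda>k. norm (sq_iterate k 1)) \<longlonglongrightarrow> 0"
    using chain[of "Suc N"] by (simp del: of_nat_Suc)
  then have "eventually (\<lambda>k. norm (sq_iterate k 1) < 1 / 2) sequentially"
    by (rule order_tendstoD) simp
  then obtain k where k: "norm (sq_iterate k 1) < 1 / 2"
    by (auto simp: eventually_sequentially)
  have "norm ((blinfun_apply A ^^ (2 ^ k)) x) \<le> norm x / 2" for x
    using norm_blinfun[of "sq_iterate k 1" x] mult_right_mono[OF less_imp_le[OF k] norm_ge_zero[of x]]
    by (simp add: sq_iterate_power)
  then show ?thesis
    by (intro exI[of _ "2 ^ k"]) simp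
qed

end

text \<open>
Division with remainder by \<open>n\<close> gives the rate \<open>r\<close> with \<open>r\<^sup>n = 1 / 2\<close>.
\<close>
lemma exponential_decay_of_power_contraction:
  fixes A :: "'b::real_normed_vector \<Rightarrow>\<^sub>L 'b"
  assumes "n > 0" and half: "\<And>x. norm ((blinfun_apply A ^^ n) x) \<le> norm x / 2"
  shows "\<exists>C r. 0 < r \<and> r < 1 \<and> (\<forall>m x. norm ((blinfun_apply A ^^ m) x) \<le> C * r ^ m * norm x)"
proof -
  define a where "a = max 1 (norm A)"
  define r where "r = root n (1 / 2)"
  have r: "0 < r" "r < 1" "r ^ n = 1 / 2"
    using \<open>n > 0\<close> by (auto simp: r_def)
  have pow: "norm ((blinfun_apply A ^^ m) x) \<le> a ^ m * norm x" for m x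
  proof (induction m)
    case (Suc m)
    have "norm ((blinfun_apply A ^^ Suc m) x) \<le> norm A * norm ((blinfun_apply A ^^ m) x)"
      by (simp add: norm_blinfun)
    also have "\<dots> \<le> a * (a ^ m * norm x)"
      by (intro mult_mono Suc) (auto simp: a_def)
    finally show ?case
      by simp
  qed simp
  have mult: "norm ((blinfun_apply A ^^ (q * n)) x) \<le> (1 / 2) ^ q * norm x" for q x
  proof (induction q)
    case (Suc q)
    have "norm ((blinfun_apply A ^^ (Suc q * n)) x) \<le> norm ((blinfun_apply A ^^ (q * n)) x) / 2"
      using half by (simp add: funpow_add)
    then show ?case
      using Suc by simp
  qed simp
  have "norm ((blinfun_apply A ^^ m) x) \<le> (2 * a ^ n) * r ^ m * norm x" for m x
  proof -
    let ?q = "m div n" and ?l = "m mod n"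
    have "norm ((blinfun_apply A ^^ (?q * n + ?l)) x) \<le> (1 / 2) ^ ?q * (a ^ ?l * norm x)"
      unfolding funpow_add o_def
      by (rule order_trans[OF mult]) (intro mult_left_mono pow, simp)
    then have "norm ((blinfun_apply A ^^ m) x) \<le> (1 / 2) ^ ?q * (a ^ ?l * norm x)"
      by simp
    also have "a ^ ?l \<le> a ^ n"
      using \<open>n > 0\<close> by (intro power_increasing) (auto simp: a_def intro: less_imp_le)
    also have "(1 / 2) ^ ?q \<le> 2 * r ^ m"
    proof -
      have "r ^ (?q * n) = (1 / 2) ^ ?q"
        by (metis r(3) power_mult mult.commute)
      then have "(1 / 2) ^ ?q = 2 * (r ^ (?q * n) * r ^ n)"
        using r by simp
      also have "\<dots> = 2 * r ^ (?q * n + n)"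
        by (simp add: power_add)
      also have "\<dots> \<le> 2 * r ^ m"
        using r \<open>n > 0\<close> by (intro mult_left_mono power_decreasing)
          (auto simp: dividend_less_div_times less_imp_le add.commute)
      finally show ?thesis .
    qed
    finally show ?thesis
      using r by (simp add: mult_right_mono algebra_simps a_def)
  qed
  with r show ?thesis
    by blast
qed

text \<open>
Extending the restriction of \<open>S\<close> to \<open>E\<close> by zero along the projection \<open>P\<close> gives the operator \<open>S P\<close> on the
whole space, and the resolvents of the restriction extend by the identity on the kernel of \<open>P\<close>. In this
way operators on a closed subspace are treated without a type for the subspace.
\<close>
lemma spectrum_in_disc_imp_exponential_decay:
  fixes s :: "complex \<Rightarrow> 'b::banach \<Rightarrow> 'b"
  assumes "vector_space s" and s_of_real: "\<And>r x. s (of_real r) x = r *\<^sub>R x"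
    and norm_s: "\<And>z x. norm (s z x) \<le> K * cmod z * norm x" and "K \<ge> 0"
    and P: "bounded_linear P" "\<And>z x. P (s z x) = s z (P x)" "\<And>x. P x \<in> E" "\<And>x. x \<in> E \<Longrightarrow> P x = x"
    and S: "bounded_linear S" "\<And>z x. S (s z x) = s z (S x)" "S ` E \<subseteq> E"
    and spec: "spectrum_on s E S \<subseteq> ball 0 1"
  shows "\<exists>C r. 0 < r \<and> r < 1 \<and> (\<forall>n x. norm ((S ^^ n) (P x)) \<le> C * r ^ n * norm x)"
proof -
  interpret vector_space s by fact
  interpret P: bounded_linear P by fact
  interpret S: bounded_linear S by fact
  define A where "A = Blinfun (\<lambda>x. S (P x))"
  have A [simp]: "blinfun_apply A = (\<lambda>x. S (P x))"
    unfolding A_def using bounded_linear_compose[OF S(1) P(1)]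
    by (simp add: bounded_linear_Blinfun_apply)
  interpret complex_linear_operator s K A
    by unfold_locales (simp_all add: s_of_real norm_s P S)
  have "\<exists>R. is_resolvent 0 z R" if z: "cmod z \<le> 1" for z
  proof (cases "z = 0")
    case True
    then have "is_resolvent 0 z id_blinfun"
      by (simp add: is_resolvent_def)
    then show ?thesis ..
  next
    case False
    then have "cmod (1 / z) \<ge> 1"
      using z by (simp add: norm_divide)
    then have "1 / z \<notin> spectrum_on s E S"
      using spec by (auto simp: subset_iff)
    then obtain R where "bounded_operator_on s E R"
      and R_inv: "\<And>x. x \<in> E \<Longrightarrow> R (S x - s (1 / z) x) = x" "\<And>x. x \<in> E \<Longrightarrow> S (R x) - s (1 / z) (R x) = x"
      unfolding spectrum_on_def by blast
    then have R: "R ` E \<subseteq> E" "\<And>x y. x \<in> E \<Longrightarrow> y \<in> E \<Longrightarrow> R (x + y) = R x + R y"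
        "\<And>c x. x \<in> E \<Longrightarrow> R (s c x) = s c (R x)" and "\<exists>L. \<forall>x\<in>E. norm (R x) \<le> L * norm x"
      by (simp_all add: bounded_operator_on_def)
    then obtain L where L: "\<And>x. x \<in> E \<Longrightarrow> norm (R x) \<le> L * norm x"
      by blast
    \<comment> \<open>For \<open>x\<close> in \<open>E\<close> this is the inverse of \<open>1 - z S = - z (S - 1 / z)\<close>; on the kernel of \<open>P\<close> it is
      the identity.\<close>
    define V where "V x = (x - P x) - s (1 / z) (R (P x))" for x
    obtain L' where L': "\<And>x. norm (P x) \<le> norm x * L'"
      using P.bounded by blast
    have RP: "bounded_linear (\<lambda>x. R (P x))"
    proof (rule bounded_linear_intro)
      show "R (P (x + y)) = R (P x) + R (P y)" for x y
        by (simp add: P.add R P)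
      show "R (P (r *\<^sub>R x)) = r *\<^sub>R R (P x)" for r x
        using R(3)[OF P(3), of "of_real r" x] by (simp add: P.scaleR s_of_real)
      show "norm (R (P x)) \<le> norm x * (\<bar>L\<bar> * L')" for x
      proof -
        have "norm (R (P x)) \<le> \<bar>L\<bar> * norm (P x)"
          using L[OF P(3), of x] mult_right_mono[OF abs_ge_self[of L] norm_ge_zero[of "P x"]]
          by linarith
        also have "\<dots> \<le> \<bar>L\<bar> * (norm x * L')"
          by (intro mult_left_mono L') simp
        finally show ?thesis
          by (simp add: algebra_simps)
      qed
    qed
    have "bounded_linear (\<lambda>x. scale_op (1 / z) (R (P x)))"
      by (rule bounded_linear_compose[OF blinfun.bounded_linear_right RP])
    then have "bounded_linear (\<lambda>x. (x - P x) - scale_op (1 / z) (R (P x)))"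
      by (intro bounded_linear_sub bounded_linear_ident P(1))
    then have V: "blinfun_apply (Blinfun V) = V"
      unfolding V_def[abs_def] by (simp add: bounded_linear_Blinfun_apply)
    have SP: "P (S (P x)) = S (P x)" and RP: "P (R (P x)) = R (P x)" for x
      using P S(3) R(1) by blast+
    have "V (x - s z (S (P x))) = x" for x
    proof -
      have eq: "P (x - s z (S (P x))) = s (- z) (P (S (P x) - s (1 / z) (P x)))"
        using False by (simp add: P.diff P SP scale_right_diff_distrib)
      have "P (S (P x) - s (1 / z) (P x)) = S (P x) - s (1 / z) (P x)"
        by (simp add: P.diff P SP)
      then have "R (P (x - s z (S (P x)))) = s (- z) (P x)"
        unfolding eq using R(3)[OF P(3)] R_inv(1)[OF P(3)] by metis
      then show ?thesis
        using False by (simp add: V_def P.diff P SP)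
    qed
    moreover have "V x - s z (S (P (V x))) = x" for x
    proof -
      have "S (R (P x)) = P x + s (1 / z) (R (P x))"
        using R_inv(2)[OF P(3), of x] by (simp add: algebra_simps)
      then show ?thesis
        using False by (simp add: V_def P.diff P S S.diff S.neg RP scale_right_distrib scale_right_diff_distrib)
    qed
    ultimately have "is_resolvent 0 z (Blinfun V)"
      by (simp add: is_resolvent_def V)
    then show ?thesis ..
  qed
  then obtain n where n: "n > 0" "\<And>x. norm ((blinfun_apply A ^^ n) x) \<le> norm x / 2"
    using power_contraction \<open>K \<ge> 0\<close> by blast
  obtain C r where r: "0 < r" "r < 1" and C: "\<And>m x. norm ((blinfun_apply A ^^ m) x) \<le> C * r ^ m * norm x"
    using exponential_decay_of_power_contraction[OF n] by blast
  have iter: "(blinfun_apply A ^^ m) (P x) = (S ^^ m) (P x) \<and> (S ^^ m) (P x) \<in> E" for m x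
    by (induction m) (use P S(3) in auto)
  obtain L where L: "\<And>x. norm (P x) \<le> norm x * L" "L > 0"
    using P.pos_bounded by blast
  have "norm ((S ^^ m) (P x)) \<le> \<bar>C\<bar> * L * r ^ m * norm x" for m x
  proof -
    have "norm ((S ^^ m) (P x)) \<le> C * r ^ m * norm (P x)"
      using C[of m "P x"] iter by simp
    also have "\<dots> \<le> \<bar>C\<bar> * r ^ m * (norm x * L)"
      using r L by (intro mult_mono) auto
    finally show ?thesis
      by (simp add: algebra_simps)
  qed
  with r show ?thesis
    by blast
qed

lemma norm_complexification_scale:
  fixes w :: "'a::real_normed_vector \<times> 'a"
  shows "norm (complexification_scale z w) \<le> 4 * cmod z * norm w"
proof -
  obtain x y where w: "w = (x, y)"
    by (cases w)
  have xy: "norm x \<le> norm w" "norm y \<le> norm w"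
    using norm_fst_le[of x y] norm_snd_le[of y x] by (simp_all add: w)
  have le: "norm (c *\<^sub>R u) \<le> cmod z * norm w" if "\<bar>c\<bar> \<le> cmod z" "norm u \<le> norm w" for c and u :: 'a
    using that by (simp add: mult_mono)
  have "norm (complexification_scale z w) \<le>
      norm (Re z *\<^sub>R x - Im z *\<^sub>R y) + norm (Re z *\<^sub>R y + Im z *\<^sub>R x)"
    unfolding complexification_scale_def w by (simp add: norm_Pair_le)
  also have "\<dots> \<le> (cmod z * norm w + cmod z * norm w) + (cmod z * norm w + cmod z * norm w)"
    by (intro add_mono order_trans[OF norm_triangle_ineq4] order_trans[OF norm_triangle_ineq] le xy
        abs_Re_le_cmod abs_Im_le_cmod)
  finally show ?thesis
    by simp
qed

text \<open>
The real case follows by restricting the estimate for the complexification to vectors with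
imaginary part zero.
\<close>
lemma real_spectrum_in_disc_imp_exponential_decay:
  fixes S P :: "'a::banach \<Rightarrow> 'a"
  assumes P: "bounded_linear P" "\<And>x. P x \<in> E" "\<And>x. x \<in> E \<Longrightarrow> P x = x"
    and S: "bounded_linear S" "S ` E \<subseteq> E"
    and spec: "real_spectrum_on E S \<subseteq> ball 0 1"
  shows "\<exists>C r. 0 < r \<and> r < 1 \<and> (\<forall>n x. norm ((S ^^ n) (P x)) \<le> C * r ^ n * norm x)"
proof -
  have bl: "bounded_linear (map_prod L L)" if "bounded_linear L" for L :: "'a \<Rightarrow> 'a"
    unfolding map_prod_def case_prod_beta
    by (intro bounded_linear_Pair bounded_linear_compose[OF that] bounded_linear_fst bounded_linear_snd)
  have scale: "map_prod L L (complexification_scale z w) = complexification_scale z (map_prod L L w)"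
    if "bounded_linear L" for L :: "'a \<Rightarrow> 'a" and z w
  proof -
    interpret bounded_linear L by fact
    show ?thesis
      by (cases w) (simp add: complexification_scale_def add diff scaleR)
  qed
  have "\<exists>C r. 0 < r \<and> r < 1 \<and> (\<forall>n x. norm ((map_prod S S ^^ n) (map_prod P P x)) \<le> C * r ^ n * norm x)"
  proof (rule spectrum_in_disc_imp_exponential_decay
      [where s = complexification_scale and E = "E \<times> E" and K = 4])
    show "complexification_scale (of_real r) w = r *\<^sub>R w" for r and w :: "'a \<times> 'a"
      by (cases w) (simp add: complexification_scale_def)
    show "map_prod S S ` (E \<times> E) \<subseteq> E \<times> E"
      using S(2) by auto
    show "map_prod P P w \<in> E \<times> E" for w
      using P(2) by (cases w) simp
    show "map_prod P P w = w" if "w \<in> E \<times> E" for w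
      using that P(3) by (cases w) simp
    show "spectrum_on complexification_scale (E \<times> E) (map_prod S S) \<subseteq> ball 0 1"
      using spec unfolding real_spectrum_on_def .
  qed (simp_all add: vector_space_complexification_scale norm_complexification_scale bl scale P(1) S(1))
  then obtain C r where r: "0 < r" "r < 1"
    and C: "\<And>n x. norm ((map_prod S S ^^ n) (map_prod P P x)) \<le> C * r ^ n * norm x"
    by blast
  have "norm ((S ^^ n) (P x)) \<le> C * r ^ n * norm x" for n x
  proof -
    have "(map_prod S S ^^ n) (u, v) = ((S ^^ n) u, (S ^^ n) v)" for u v
      by (induction n) auto
    then have "norm ((S ^^ n) (P x)) \<le> norm ((map_prod S S ^^ n) (map_prod P P (x, 0)))"
      using norm_fst_le[of "(S ^^ n) (P x)" "(S ^^ n) (P 0)"] by simp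
    also have "\<dots> \<le> C * r ^ n * norm x"
      using C[of n "(x, 0)"] by (simp add: norm_Pair)
    finally show ?thesis .
  qed
  with r show ?thesis
    by blast
qed

section \<open>The cohomological equation\<close>

text \<open>
The arguments may grow at a rate \<open>q > 1\<close> as long as \<open>r * q < 1\<close>: the case \<open>q = 1\<close> serves for bounded
functions, larger \<open>q\<close> for Hoelder differences along diverging orbits.
\<close>
lemma weighted_series_bound:
  fixes U :: "nat \<Rightarrow> 'a::banach \<Rightarrow> 'a"
  assumes U: "\<And>n x. norm (U n x) \<le> C * r ^ n * norm x" and a: "\<And>n. norm (a n) \<le> b * q ^ n"
    and "0 \<le> C" "0 \<le> r" "0 \<le> q" "r * q < 1"
  shows "summable (\<lambda>n. U n (a n))" "norm (\<Sum>n. U n (a n)) \<le> C / (1 - r * q) * b"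
proof -
  have bound: "norm (U n (a n)) \<le> (C * b) * (r * q) ^ n" for n
  proof -
    have "norm (U n (a n)) \<le> C * r ^ n * (b * q ^ n)"
      using assms by (intro order_trans[OF U] mult_left_mono) auto
    then show ?thesis
      by (simp add: power_mult_distrib ac_simps)
  qed
  have geo: "summable (\<lambda>n. (C * b) * (r * q) ^ n)"
    using assms by (intro summable_mult summable_geometric) simp
  then have norm: "summable (\<lambda>n. norm (U n (a n)))"
    by (rule summable_comparison_test') (use bound in simp)
  then show "summable (\<lambda>n. U n (a n))"
    by (rule summable_norm_cancel)
  have "norm (\<Sum>n. U n (a n)) \<le> (\<Sum>n. norm (U n (a n)))"
    by (rule summable_norm[OF norm])
  also have "\<dots> \<le> (\<Sum>n. (C * b) * (r * q) ^ n)"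
    by (intro suminf_le bound norm geo)
  also have "\<dots> = (C * b) * (1 / (1 - r * q))"
    using assms by (subst suminf_mult) (auto simp: suminf_geometric summable_geometric)
  finally show "norm (\<Sum>n. U n (a n)) \<le> C / (1 - r * q) * b"
    by simp
qed

lemma funpow_lipschitz:
  fixes g :: "'a::real_normed_vector \<Rightarrow> 'a"
  assumes "\<And>x y. norm (g x - g y) \<le> M * norm (x - y)" "M \<ge> 0"
  shows "norm ((g ^^ n) x - (g ^^ n) y) \<le> M ^ n * norm (x - y)"
proof (induction n)
  case (Suc n)
  have "norm ((g ^^ Suc n) x - (g ^^ Suc n) y) \<le> M * norm ((g ^^ n) x - (g ^^ n) y)"
    using assms by simp
  also have "\<dots> \<le> M * (M ^ n * norm (x - y))"
    by (intro mult_left_mono Suc assms)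
  finally show ?case
    by (simp add: mult.assoc)
qed simp

lemma funpow_intertwine:
  assumes "\<And>x. g (K x) = K (g' x)"
  shows "(g ^^ n) (K x) = K ((g' ^^ n) x)"
  by (induction n) (auto simp: assms)

lemma continuous_on_of_holder:
  fixes h :: "'a::real_normed_vector \<Rightarrow> 'b::real_normed_vector"
  assumes "\<And>x y. norm (h x - h y) \<le> c * norm (x - y) powr \<theta>" "\<theta> > 0"
  shows "continuous_on S h"
  unfolding continuous_on_def
proof
  fix x
  assume "x \<in> S"
  have "((\<lambda>y. norm (y - x)) \<longlongrightarrow> 0) (at x within S)"
    by (intro tendsto_norm_zero) (simp add: LIM_zero)
  then have "((\<lambda>y. norm (y - x) powr \<theta>) \<longlongrightarrow> 0) (at x within S)"
    using \<open>\<theta> > 0\<close> by (intro tendsto_zero_powrI[OF _ tendsto_const]) auto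
  then have "((\<lambda>y. c * norm (y - x) powr \<theta>) \<longlongrightarrow> 0) (at x within S)"
    by (rule tendsto_mult_right_zero)
  then have "((\<lambda>y. h y - h x) \<longlongrightarrow> 0) (at x within S)"
    by (rule Lim_null_comparison[rotated]) (simp add: assms(1))
  then show "(h \<longlongrightarrow> h x) (at x within S)"
    by (rule LIM_zero_cancel)
qed

locale linear_splitting =
  fixes T Ti P Q :: "'a::banach \<Rightarrow> 'a" and C r :: real
  assumes T: "bounded_linear T" and Ti: "bounded_linear Ti"
    and T_Ti: "T (Ti x) = x" and Ti_T: "Ti (T x) = x"
    and P: "bounded_linear P" and Q: "bounded_linear Q" and Q_P: "Q x + P x = x"
    and C_nonneg: "0 \<le> C" and r_pos: "0 < r" and r_less_1: "r < 1"
    and decay_P: "norm ((T ^^ n) (P x)) \<le> C * r ^ n * norm x"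
    and decay_Q: "norm ((Ti ^^ n) (Q x)) \<le> C * r ^ n * norm x"
begin

interpretation T: bounded_linear T by (rule T)
interpretation Ti: bounded_linear Ti by (rule Ti)
interpretation P: bounded_linear P by (rule P)
interpretation Q: bounded_linear Q by (rule Q)

text \<open>
The distinguished solution \<open>\<psi>\<close> of \<open>T \<psi> - \<psi> \<circ> G = \<phi>\<close>, where \<open>Gi\<close> is the inverse of \<open>G\<close>. The
\<open>Q\<close>-component is summed along forward orbits and the \<open>P\<close>-component along backward orbits, each in
the direction in which the linear part contracts.
\<close>
definition cohom_solution :: "('a \<Rightarrow> 'a) \<Rightarrow> ('a \<Rightarrow> 'a) \<Rightarrow> ('a \<Rightarrow> 'a) \<Rightarrow> 'a \<Rightarrow> 'a" where
  "cohom_solution G Gi \<phi> x =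
    (\<Sum>n. (Ti ^^ Suc n) (Q (\<phi> ((G ^^ n) x)))) - (\<Sum>n. (T ^^ n) (P (\<phi> ((Gi ^^ Suc n) x))))"

lemma decay_Q_Suc: "norm ((Ti ^^ Suc n) (Q x)) \<le> C * r ^ n * norm x"
proof -
  have "norm ((Ti ^^ Suc n) (Q x)) \<le> C * r ^ Suc n * norm x"
    by (rule decay_Q)
  also have "\<dots> \<le> C * r ^ n * norm x"
    using r_pos r_less_1 C_nonneg by (intro mult_right_mono mult_left_mono power_decreasing) auto
  finally show ?thesis .
qed

lemma funpow_diff:
  "(T ^^ n) (x - y) = (T ^^ n) x - (T ^^ n) y"
  "(Ti ^^ n) (x - y) = (Ti ^^ n) x - (Ti ^^ n) y"
  by (induction n) (auto simp: T.diff Ti.diff)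

lemma cohom_summable:
  assumes "\<And>n. norm (a n) \<le> b"
  shows "summable (\<lambda>n. (Ti ^^ Suc n) (Q (a n)))" "summable (\<lambda>n. (T ^^ n) (P (a n)))"
proof -
  have "norm (a n) \<le> b * 1 ^ n" for n
    using assms by simp
  note bound = this
  have "0 \<le> r" "(0 :: real) \<le> 1" "r * 1 < 1"
    using r_pos r_less_1 by auto
  note series = weighted_series_bound(1)[OF _ bound C_nonneg this]
  show "summable (\<lambda>n. (Ti ^^ Suc n) (Q (a n)))"
    by (rule series[OF decay_Q_Suc])
  show "summable (\<lambda>n. (T ^^ n) (P (a n)))"
    by (rule series[OF decay_P])
qed

text \<open>
The common source of the bound, the contraction estimate and the Hoelder estimate: only the growth of
the difference along the two orbits matters, and the two orbits may belong to different maps.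
\<close>
lemma cohom_diff_bound:
  assumes "\<And>x. norm (\<phi> x) \<le> b" "\<And>x. norm (\<psi> x) \<le> b"
    and "0 \<le> q" "r * q < 1"
    and forward: "\<And>n. norm (\<phi> ((G ^^ n) x) - \<psi> ((G' ^^ n) y)) \<le> d * q ^ n"
    and backward: "\<And>n. norm (\<phi> ((Gi ^^ Suc n) x) - \<psi> ((Gi' ^^ Suc n) y)) \<le> d * q ^ n"
  shows "norm (cohom_solution G Gi \<phi> x - cohom_solution G' Gi' \<psi> y) \<le> 2 * C / (1 - r * q) * d"
proof -
  have "cohom_solution G Gi \<phi> x - cohom_solution G' Gi' \<psi> y =
    ((\<Sum>n. (Ti ^^ Suc n) (Q (\<phi> ((G ^^ n) x)))) - (\<Sum>n. (Ti ^^ Suc n) (Q (\<psi> ((G' ^^ n) y))))) -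
    ((\<Sum>n. (T ^^ n) (P (\<phi> ((Gi ^^ Suc n) x)))) - (\<Sum>n. (T ^^ n) (P (\<psi> ((Gi' ^^ Suc n) y)))))"
    unfolding cohom_solution_def by (simp only: algebra_simps)
  also have "\<dots> = (\<Sum>n. (Ti ^^ Suc n) (Q (\<phi> ((G ^^ n) x) - \<psi> ((G' ^^ n) y)))) -
    (\<Sum>n. (T ^^ n) (P (\<phi> ((Gi ^^ Suc n) x) - \<psi> ((Gi' ^^ Suc n) y))))"
    unfolding suminf_diff[OF cohom_summable(1)[OF assms(1)] cohom_summable(1)[OF assms(2)]]
      suminf_diff[OF cohom_summable(2)[OF assms(1)] cohom_summable(2)[OF assms(2)]]
    by (simp only: funpow_diff P.diff Q.diff)
  also have "norm \<dots> \<le> C / (1 - r * q) * d + C / (1 - r * q) * d"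
    using weighted_series_bound(2)[OF decay_Q_Suc forward C_nonneg less_imp_le[OF r_pos] assms(3,4)]
      weighted_series_bound(2)[OF decay_P backward C_nonneg less_imp_le[OF r_pos] assms(3,4)]
    by (intro order_trans[OF norm_triangle_ineq4] add_mono)
  also have "\<dots> = 2 * C / (1 - r * q) * d"
    by simp
  finally show ?thesis .
qed

lemma cohom_zero: "cohom_solution G Gi (\<lambda>_. 0) x = 0"
proof -
  have "(T ^^ n) 0 = 0" "(Ti ^^ n) 0 = 0" for n
    by (induction n) (auto simp: T.zero Ti.zero)
  then show ?thesis
    by (simp add: cohom_solution_def P.zero Q.zero del: funpow.simps)
qed

lemma cohom_bound:
  assumes "\<And>x. norm (\<phi> x) \<le> b"
  shows "norm (cohom_solution G Gi \<phi> x) \<le> 2 * C / (1 - r) * b"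
proof -
  have "b \<ge> 0"
    using assms norm_ge_zero order_trans by blast
  then show ?thesis
    using cohom_diff_bound[of \<phi> b "\<lambda>_. 0" 1 G x G x b Gi Gi] assms r_less_1
    by (simp add: cohom_zero)
qed

lemma cohom_equation:
  assumes \<phi>: "\<And>x. norm (\<phi> x) \<le> b" and Gi: "\<And>x. Gi (G x) = x"
  shows "T (cohom_solution G Gi \<phi> x) = cohom_solution G Gi \<phi> (G x) + \<phi> x"
proof -
  let ?u = "\<lambda>n. (Ti ^^ n) (Q (\<phi> ((G ^^ n) x)))"
  let ?v = "\<lambda>n. (T ^^ n) (P (\<phi> ((Gi ^^ n) x)))"
  have shift: "(G ^^ n) (G x) = (G ^^ Suc n) x" "(Gi ^^ Suc n) (G x) = (Gi ^^ n) x" for n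
    by (simp_all add: funpow_swap1 Gi)
  have u: "summable (\<lambda>n. ?u (Suc n))" and v: "summable ?v"
    by (rule cohom_summable[OF \<phi>])+
  have "T (\<Sum>n. (Ti ^^ Suc n) (Q (\<phi> ((G ^^ n) x)))) = (\<Sum>n. T ((Ti ^^ Suc n) (Q (\<phi> ((G ^^ n) x)))))"
    by (rule T.suminf) (rule cohom_summable(1)[OF \<phi>])
  also have "\<dots> = (\<Sum>n. ?u n)"
    by (simp add: T_Ti)
  also have "\<dots> = (\<Sum>n. ?u (Suc n)) + Q (\<phi> x)"
    using suminf_split_head[of ?u] u summable_Suc_iff[of ?u] by simp
  finally have 1: "T (\<Sum>n. (Ti ^^ Suc n) (Q (\<phi> ((G ^^ n) x)))) = (\<Sum>n. ?u (Suc n)) + Q (\<phi> x)" .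
  have "T (\<Sum>n. (T ^^ n) (P (\<phi> ((Gi ^^ Suc n) x)))) = (\<Sum>n. ?v (Suc n))"
    using T.suminf[OF cohom_summable(2)[OF \<phi>]] by simp
  also have "\<dots> = (\<Sum>n. ?v n) - P (\<phi> x)"
    using suminf_split_head[OF v] by simp
  finally have 2: "T (\<Sum>n. (T ^^ n) (P (\<phi> ((Gi ^^ Suc n) x)))) = (\<Sum>n. ?v n) - P (\<phi> x)" .
  have "T (cohom_solution G Gi \<phi> x) = ((\<Sum>n. ?u (Suc n)) - (\<Sum>n. ?v n)) + (Q (\<phi> x) + P (\<phi> x))"
    unfolding cohom_solution_def T.diff 1 2 by (simp only: algebra_simps)
  also have "(\<Sum>n. ?u (Suc n)) - (\<Sum>n. ?v n) = cohom_solution G Gi \<phi> (G x)"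
    unfolding cohom_solution_def shift ..
  finally show ?thesis
    by (simp only: Q_P)
qed

text \<open>
Naturality of the solution. It replaces the uniqueness of bounded solutions, which can fail for
generalized hyperbolic operators.
\<close>
lemma cohom_intertwine:
  assumes "\<And>x. G (K x) = K (G' x)" "\<And>x. Gi (K x) = K (Gi' x)"
  shows "cohom_solution G Gi \<phi> (K x) = cohom_solution G' Gi' (\<lambda>x. \<phi> (K x)) x"
  unfolding cohom_solution_def
  by (simp only: funpow_intertwine[of G K G', OF assms(1)] funpow_intertwine[of Gi K Gi', OF assms(2)])

lemma cohom_holder:
  assumes \<phi>: "\<And>x. norm (\<phi> x) \<le> b" "\<And>x y. norm (\<phi> x - \<phi> y) \<le> D * norm (x - y) powr \<theta>"
    and G: "\<And>x y. norm (G x - G y) \<le> M * norm (x - y)"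
    and Gi: "\<And>x y. norm (Gi x - Gi y) \<le> M * norm (x - y)"
    and "M \<ge> 1" "\<theta> > 0" "r * M powr \<theta> < 1" "D \<ge> 0"
  shows "norm (cohom_solution G Gi \<phi> x - cohom_solution G Gi \<phi> y) \<le>
    2 * C * M powr \<theta> / (1 - r * M powr \<theta>) * D * norm (x - y) powr \<theta>"
proof -
  have "norm (\<phi> u - \<phi> v) \<le> D * M powr \<theta> * norm (x - y) powr \<theta> * (M powr \<theta>) ^ n"
    if "norm (u - v) \<le> M ^ Suc n * norm (x - y)" for u v n
  proof -
    have "norm (u - v) powr \<theta> \<le> (M ^ Suc n * norm (x - y)) powr \<theta>"
      using that \<open>\<theta> > 0\<close> by (intro powr_mono2) auto
    also have "\<dots> = (M powr \<theta>) ^ Suc n * norm (x - y) powr \<theta>"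
      using \<open>M \<ge> 1\<close> by (simp only: powr_mult powr_realpow[symmetric] powr_powr powr_gt_zero mult.commute)
    finally have "D * norm (u - v) powr \<theta> \<le> D * ((M powr \<theta>) ^ Suc n * norm (x - y) powr \<theta>)"
      using \<open>D \<ge> 0\<close> by (intro mult_left_mono)
    then show ?thesis
      using \<phi>(2)[of u v] by (simp add: ac_simps)
  qed
  moreover have "norm ((G ^^ n) x - (G ^^ n) y) \<le> M ^ Suc n * norm (x - y)" for n
  proof (rule order_trans[OF funpow_lipschitz[OF G]])
    show "M ^ n * norm (x - y) \<le> M ^ Suc n * norm (x - y)"
      using \<open>M \<ge> 1\<close> by (intro mult_right_mono power_increasing) auto
  qed (use \<open>M \<ge> 1\<close> in simp)
  moreover have "norm ((Gi ^^ Suc n) x - (Gi ^^ Suc n) y) \<le> M ^ Suc n * norm (x - y)" for n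
    using \<open>M \<ge> 1\<close> by (intro funpow_lipschitz Gi) simp
  ultimately have "norm (cohom_solution G Gi \<phi> x - cohom_solution G Gi \<phi> y) \<le>
      2 * C / (1 - r * M powr \<theta>) * (D * M powr \<theta> * norm (x - y) powr \<theta>)"
    using assms(7) by (intro cohom_diff_bound[OF \<phi>(1) \<phi>(1)]) auto
  then show ?thesis
    by (simp add: ac_simps)
qed

end

text \<open>
The bound \<open>\<epsilon> / 2\<close> on the values of \<open>f\<close> means that \<open>f\<close> oscillates by at most \<open>\<epsilon>\<close>; with it the \<open>\<theta>\<close>-Hoelder
constant of \<open>f\<close> is again \<open>\<epsilon>\<close>. By the last assumption, \<open>L\<^sub>G (f \<circ> u)\<close> and \<open>L\<^sub>T (f \<circ> u)\<close> depend on \<open>u\<close>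
contractively, with factor \<open>1 / 2\<close> in the supremum norm, and \<open>L\<^sub>G\<close> and \<open>L\<^sub>T\<close> turn the Hoelder constant
\<open>2 * \<epsilon>\<close> into \<open>1\<close>.
\<close>
locale perturbed_splitting = linear_splitting +
  fixes f G Gi :: "'a::banach \<Rightarrow> 'a" and \<epsilon> M \<theta> :: real
  assumes f_lipschitz: "norm (f x - f y) \<le> \<epsilon> * norm (x - y)"
    and f_bound: "norm (f x) \<le> \<epsilon> / 2"
    and G_def: "G x = T x + f x" and Gi_G: "Gi (G x) = x" and G_Gi: "G (Gi x) = x"
    and M: "M \<ge> 1"
    and T_lipschitz: "norm (T x - T y) \<le> M * norm (x - y)"
    and Ti_lipschitz: "norm (Ti x - Ti y) \<le> M * norm (x - y)"
    and G_lipschitz: "norm (G x - G y) \<le> M * norm (x - y)"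
    and Gi_lipschitz: "norm (Gi x - Gi y) \<le> M * norm (x - y)"
    and \<theta>: "0 < \<theta>" "\<theta> \<le> 1" "r * M powr \<theta> < 1"
    and small_perturbation: "2 * C * M powr \<theta> / (1 - r * M powr \<theta>) * \<epsilon> \<le> 1 / 2"
begin

definition \<Lambda> :: real where
  "\<Lambda> = 2 * C * M powr \<theta> / (1 - r * M powr \<theta>)"

lemma small: "\<Lambda> * \<epsilon> \<le> 1 / 2"
  using small_perturbation by (simp add: \<Lambda>_def)

lemma \<epsilon>_nonneg: "\<epsilon> \<ge> 0"
  using order_trans[OF norm_ge_zero f_bound[of 0]] by simp

lemma \<Lambda>_dominates: "2 * C / (1 - r) \<le> \<Lambda>"
proof -
  have "1 \<le> M powr \<theta>"
    using M \<theta> by (intro ge_one_powr_ge_zero) auto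
  moreover from this have "r \<le> r * M powr \<theta>"
    using r_pos by simp
  ultimately show ?thesis
    unfolding \<Lambda>_def using C_nonneg \<theta> by (intro frac_le) (auto simp: mult_le_cancel_left1)
qed

text \<open>
Points at distance at most \<open>1\<close> are controlled by the Lipschitz constant of \<open>f\<close>, as there the distance is at
most its \<open>\<theta>\<close>-th power; points further apart are controlled by the bound on \<open>f\<close>.
\<close>
lemma f_holder:
  assumes k: "\<And>x y. norm (k x - k y) \<le> L * norm (x - y) powr \<theta>" and "L \<ge> 0"
  shows "norm (f (x + k x) - f (y + k y)) \<le> \<epsilon> * (1 + L) * norm (x - y) powr \<theta>"
proof (cases "norm (x - y) \<le> 1")
  case True
  have le: "norm (x - y) \<le> norm (x - y) powr \<theta>"
    using powr_mono'[of \<theta> 1 "norm (x - y)"] True \<theta> by simp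
  have "norm ((x + k x) - (y + k y)) \<le> norm (x - y) + norm (k x - k y)"
    using norm_triangle_ineq[of "x - y" "k x - k y"] by (simp add: algebra_simps)
  also have "\<dots> \<le> (1 + L) * norm (x - y) powr \<theta>"
    using k[of x y] le by (simp add: distrib_right)
  finally have "\<epsilon> * norm ((x + k x) - (y + k y)) \<le> \<epsilon> * ((1 + L) * norm (x - y) powr \<theta>)"
    using \<epsilon>_nonneg by (rule mult_left_mono)
  then show ?thesis
    using f_lipschitz[of "x + k x" "y + k y"] by (simp add: mult.assoc)
next
  case False
  have "norm (f (x + k x) - f (y + k y)) \<le> \<epsilon>"
    using norm_triangle_ineq4[of "f (x + k x)" "f (y + k y)"] f_bound[of "x + k x"] f_bound[of "y + k y"]
    by linarith
  also have "\<dots> \<le> \<epsilon> * ((1 + L) * norm (x - y) powr \<theta>)"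
  proof -
    have "1 * 1 \<le> (1 + L) * norm (x - y) powr \<theta>"
      using False \<theta> \<open>L \<ge> 0\<close> by (intro mult_mono ge_one_powr_ge_zero) auto
    then show ?thesis
      using mult_left_mono[OF _ \<epsilon>_nonneg, of 1] by simp
  qed
  finally show ?thesis
    by (simp add: mult.assoc)
qed

lemma cohom_contraction:
  assumes "\<And>x. norm (u x - v x) \<le> d"
  shows "norm (cohom_solution G' Gi' (\<lambda>x. f (u x)) x - cohom_solution G' Gi' (\<lambda>x. f (v x)) x) \<le> d / 2"
proof -
  have "d \<ge> 0"
    using assms norm_ge_zero order_trans by blast
  have le: "norm (f (u z) - f (v z)) \<le> \<epsilon> * d * 1 ^ n" for n :: nat and z
    using order_trans[OF f_lipschitz mult_left_mono[OF assms \<epsilon>_nonneg]] by simp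
  have "norm (cohom_solution G' Gi' (\<lambda>x. f (u x)) x - cohom_solution G' Gi' (\<lambda>x. f (v x)) x) \<le> 2 * C / (1 - r * 1) * (\<epsilon> * d)"
    using r_less_1 by (intro cohom_diff_bound[OF f_bound f_bound] le) auto
  also have "\<dots> \<le> \<Lambda> * (\<epsilon> * d)"
    using \<Lambda>_dominates \<epsilon>_nonneg \<open>d \<ge> 0\<close> by (intro mult_right_mono) auto
  also have "\<dots> \<le> d / 2"
    using mult_right_mono[OF small \<open>d \<ge> 0\<close>] by (simp add: mult.assoc)
  finally show ?thesis .
qed

text \<open>
The contraction acts on the bounded continuous maps with Hoelder constant \<open>1\<close>. This set is invariant
because \<open>f \<circ> (id + k)\<close> then has Hoelder constant \<open>2 * \<epsilon>\<close>, which the assumption on \<open>\<epsilon>\<close> brings back to \<open>1\<close>.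
\<close>
lemma inverse_correction_exists:
  obtains k b where "\<And>x. k x = - cohom_solution T Ti (\<lambda>x. f (x + k x)) x" "\<And>x. norm (k x) \<le> b"
    "\<And>x y. norm (k x - k y) \<le> norm (x - y) powr \<theta>"
proof -
  define S where "S = {k :: 'a \<Rightarrow>\<^sub>C 'a. \<forall>x y. norm (k x - k y) \<le> norm (x - y) powr \<theta>}"
  define \<Phi> where "\<Phi> k x = - cohom_solution T Ti (\<lambda>x. f (x + apply_bcontfun k x)) x" for k x
  have holder: "norm (\<Phi> k x - \<Phi> k y) \<le> 1 * norm (x - y) powr \<theta>" if "k \<in> S" for k x y
  proof -
    have "norm (f (x + k x) - f (y + k y)) \<le> \<epsilon> * 2 * norm (x - y) powr \<theta>" for x y
      using f_holder[of k 1 x y] that by (simp add: S_def)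
    then have "norm (\<Phi> k y - \<Phi> k x) \<le> \<Lambda> * (\<epsilon> * 2) * norm (y - x) powr \<theta>" for x y
      unfolding \<Phi>_def \<Lambda>_def using \<epsilon>_nonneg T_lipschitz Ti_lipschitz M \<theta>
      by (subst minus_diff_minus, subst norm_minus_cancel)
        (intro cohom_holder[OF f_bound], auto)
    moreover have "\<Lambda> * (\<epsilon> * 2) * norm (x - y) powr \<theta> \<le> 1 * norm (x - y) powr \<theta>" for x y :: 'a
      using small by (intro mult_right_mono) auto
    ultimately show ?thesis
      using order_trans by blast
  qed
  have bound: "norm (\<Phi> k x) \<le> 2 * C / (1 - r) * (\<epsilon> / 2)" for k x
    unfolding \<Phi>_def norm_minus_cancel by (rule cohom_bound) (rule f_bound)
  have app: "apply_bcontfun (Bcontfun (\<Phi> k)) = \<Phi> k" if "k \<in> S" for k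
    by (intro Bcontfun_inverse bcontfun_normI[OF _ bound] continuous_on_of_holder[OF holder[OF that]] \<theta>(1))
  have "closed S"
  proof (rule closed_sequential_limits[THEN iffD2], intro allI impI, elim conjE)
    fix u l
    assume u: "\<forall>n. u n \<in> S" and lim: "u \<longlonglongrightarrow> l"
    have "(\<lambda>n. apply_bcontfun (u n) x) \<longlonglongrightarrow> apply_bcontfun l x" for x
      using tendsto_uniform_limitI[OF tendsto_bcontfun_uniform_limit[OF lim]] by simp
    then have norm_lim: "(\<lambda>n. norm (u n x - u n y)) \<longlonglongrightarrow> norm (l x - l y)" for x y
      by (intro tendsto_norm tendsto_diff)
    have "norm (u n x - u n y) \<le> norm (x - y) powr \<theta>" for n x y
      using u by (simp add: S_def)
    then have "norm (l x - l y) \<le> norm (x - y) powr \<theta>" for x y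
      by (intro LIMSEQ_le_const2[OF norm_lim]) simp
    then show "l \<in> S"
      by (simp add: S_def)
  qed
  have "\<exists>!k\<in>S. Bcontfun (\<Phi> k) = k"
  proof (rule Banach_fix[of _ "1 / 2"])
    show "complete S"
      using \<open>closed S\<close> by (simp add: complete_eq_closed)
    have "(0 :: 'a \<Rightarrow>\<^sub>C 'a) \<in> S"
      by (simp add: S_def)
    then show "S \<noteq> {}"
      by blast
    show "(\<lambda>k. Bcontfun (\<Phi> k)) ` S \<subseteq> S"
      using holder app by (auto simp: S_def)
    show "dist (Bcontfun (\<Phi> k)) (Bcontfun (\<Phi> l)) \<le> 1 / 2 * dist k l" if "k \<in> S" "l \<in> S" for k l
    proof (rule dist_bound)
      fix x
      have "norm ((x + l x) - (x + k x)) \<le> dist k l" for x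
        using dist_bounded[of k x l] by (simp add: dist_norm norm_minus_commute)
      then have "norm (\<Phi> k x - \<Phi> l x) \<le> dist k l / 2"
        unfolding \<Phi>_def minus_diff_minus norm_minus_cancel
        by (intro cohom_contraction) (simp add: norm_minus_commute)
      then show "dist (Bcontfun (\<Phi> k) x) (Bcontfun (\<Phi> l) x) \<le> 1 / 2 * dist k l"
        using that by (simp add: app dist_norm)
    qed
  qed auto
  then obtain k where k: "k \<in> S" "Bcontfun (\<Phi> k) = k"
    by blast
  then have fixed: "apply_bcontfun k x = \<Phi> k x" for x
    using app by metis
  show thesis
  proof (rule that[of "apply_bcontfun k"])
    show "k x = - cohom_solution T Ti (\<lambda>x. f (x + k x)) x" for x
      using fixed[of x] unfolding \<Phi>_def .
    show "norm (k x) \<le> 2 * C / (1 - r) * (\<epsilon> / 2)" for x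
      unfolding fixed[of x] by (rule bound)
    show "norm (k x - k y) \<le> norm (x - y) powr \<theta>" for x y
      using k by (simp add: S_def)
  qed
qed

text \<open>
Here \<open>H = id + L\<^sub>G f\<close>, and \<open>K = id + k\<close> with the fixed point \<open>k\<close>. That they are inverse to each other rests
on naturality in one order, and on naturality and contraction in the other.
\<close>
theorem conjugacy_exists:
  "\<exists>H K. (\<forall>x. H (K x) = x) \<and> (\<forall>x. K (H x) = x) \<and> (\<forall>x. H (G x) = T (H x)) \<and>
    (\<forall>x y. norm ((H x - x) - (H y - y)) \<le> norm (x - y) powr \<theta>) \<and>
    (\<forall>x y. norm ((K x - x) - (K y - y)) \<le> norm (x - y) powr \<theta>)"
proof -
  interpret T: bounded_linear T by (rule T)
  define h where "h = cohom_solution G Gi f"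
  obtain k b where k: "\<And>x. k x = - cohom_solution T Ti (\<lambda>x. f (x + k x)) x"
    and k_bound: "\<And>x. norm (k x) \<le> b"
    and k_holder: "\<And>x y. norm (k x - k y) \<le> norm (x - y) powr \<theta>"
    using inverse_correction_exists by blast
  define H where "H x = x + h x" for x
  define K where "K x = x + k x" for x
  have H_G: "H (G x) = T (H x)" for x
    using cohom_equation[of f "\<epsilon> / 2" Gi G x, OF f_bound Gi_G] by (simp add: H_def h_def G_def T.add)
  have G_K: "G (K x) = K (T x)" for x
  proof -
    have "T (k x) = k (T x) - f (x + k x)"
      using cohom_equation[of "\<lambda>x. f (x + k x)" "\<epsilon> / 2" Ti T x, OF f_bound Ti_T] k[of x] k[of "T x"]
      by (simp add: T.neg)
    then show ?thesis
      by (simp add: G_def K_def T.add)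
  qed
  have H_Gi: "H (Gi x) = Ti (H x)" for x
    by (metis H_G G_Gi Ti_T)
  have Gi_K: "Gi (K x) = K (Ti x)" for x
    by (metis G_K Gi_G T_Ti)
  have "h (K x) = - k x" for x
  proof -
    have "h (K x) = cohom_solution T Ti (\<lambda>x. f (K x)) x"
      unfolding h_def by (rule cohom_intertwine[of G K T Gi Ti, OF G_K Gi_K])
    then show ?thesis
      using k[of x] by (simp only: K_def minus_minus)
  qed
  then have HK: "H (K x) = x" for x
    by (simp add: H_def K_def)
  have h_bound: "norm (h x) \<le> \<Lambda> * (\<epsilon> / 2)" for x
    using cohom_bound[of f, OF f_bound, of G Gi x] mult_right_mono[OF \<Lambda>_dominates, of "\<epsilon> / 2"] \<epsilon>_nonneg
    unfolding h_def by linarith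
  have k_H: "k (H x) = - cohom_solution G Gi (\<lambda>x. f (K (H x))) x" for x
    using cohom_intertwine[of T H G Ti Gi "\<lambda>x. f (K x)" x] k[of "H x"] H_G H_Gi by (simp add: K_def)
  have defect: "K (H x) - x = cohom_solution G Gi (\<lambda>x. f x) x - cohom_solution G Gi (\<lambda>x. f (K (H x))) x" for x
  proof -
    have "K (H x) - x = h x + k (H x)"
      by (simp add: K_def H_def)
    then show ?thesis
      by (simp only: k_H h_def add_uminus_conv_diff)
  qed
  \<comment> \<open>The bound for \<open>n = 0\<close> is the sum of the bounds of \<open>k\<close> and \<open>h\<close>; the contraction halves it.\<close>
  have KH_bound: "norm (K (H x) - x) \<le> (b + \<Lambda> * (\<epsilon> / 2)) / 2 ^ n" for x n
  proof (induction n arbitrary: x)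
    case 0
    have "K (H x) - x = k (H x) + h x"
      by (simp add: K_def H_def)
    then show ?case
      using norm_triangle_ineq[of "k (H x)" "h x"] k_bound[of "H x"] h_bound[of x] by simp
  next
    case (Suc n)
    have "norm (K (H x) - x) \<le> ((b + \<Lambda> * (\<epsilon> / 2)) / 2 ^ n) / 2"
      unfolding defect by (intro cohom_contraction) (metis Suc norm_minus_commute)
    then show ?case
      by (simp add: mult.commute)
  qed
  have KH: "K (H x) = x" for x
  proof -
    have "(\<lambda>n. (b + \<Lambda> * (\<epsilon> / 2)) / 2 ^ n) \<longlonglongrightarrow> 0"
      by (intro LIMSEQ_divide_realpow_zero) simp
    then have "norm (K (H x) - x) \<le> 0"
      using KH_bound by (intro LIMSEQ_le_const) auto
    then show ?thesis
      by simp
  qed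
  have h_holder: "norm (h x - h y) \<le> norm (x - y) powr \<theta>" for x y
  proof -
    have "norm (f x - f y) \<le> \<epsilon> * norm (x - y) powr \<theta>" for x y
      using f_holder[of "\<lambda>_. 0" 0 x y] by simp
    then have "norm (h x - h y) \<le> \<Lambda> * \<epsilon> * norm (x - y) powr \<theta>"
      unfolding h_def \<Lambda>_def using \<epsilon>_nonneg G_lipschitz Gi_lipschitz M \<theta>
      by (intro cohom_holder[OF f_bound]) auto
    also have "\<dots> \<le> 1 * norm (x - y) powr \<theta>"
      using small by (intro mult_right_mono) auto
    finally show ?thesis
      by simp
  qed
  show ?thesis
  proof (rule exI[of _ H], rule exI[of _ K], intro conjI allI)
    show "norm ((H x - x) - (H y - y)) \<le> norm (x - y) powr \<theta>"
      "norm ((K x - x) - (K y - y)) \<le> norm (x - y) powr \<theta>" for x y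
      using h_holder k_holder by (simp_all add: H_def K_def)
    show "H (K x) = x" "K (H x) = x" "H (G x) = T (H x)" for x
      by (rule HK KH H_G)+
  qed
qed

end

section \<open>Perturbations of the identity and of linear maps\<close>

lemma lipschitz_perturbation_inverse:
  fixes T Ti f :: "'a::banach \<Rightarrow> 'a"
  assumes T: "bounded_linear T" and Ti: "bounded_linear Ti"
    and T_Ti: "\<And>x. T (Ti x) = x" and Ti_T: "\<And>x. Ti (T x) = x"
    and f: "\<And>x y. norm (f x - f y) \<le> \<epsilon> * norm (x - y)"
    and B: "\<And>x. norm (Ti x) \<le> B * norm x" "B \<ge> 0" "B * \<epsilon> \<le> 1 / 2"
  obtains Gi where "\<And>x. Gi (T x + f x) = x" "\<And>y. T (Gi y) + f (Gi y) = y"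
    "\<And>y y'. norm (Gi y - Gi y') \<le> 2 * B * norm (y - y')"
proof -
  interpret T: bounded_linear T by (rule T)
  interpret Ti: bounded_linear Ti by (rule Ti)
  have "\<exists>x. T x + f x = y" for y
  proof -
    have "dist (Ti (y - f x)) (Ti (y - f x')) \<le> 1 / 2 * dist x x'" for x x'
    proof -
      have "norm (Ti (y - f x) - Ti (y - f x')) \<le> B * norm (f x' - f x)"
        using B(1)[of "f x' - f x"] by (simp add: Ti.diff[symmetric])
      also have "\<dots> \<le> B * (\<epsilon> * norm (x' - x))"
        by (intro mult_left_mono f B)
      also have "\<dots> \<le> 1 / 2 * norm (x' - x)"
        using mult_right_mono[OF B(3) norm_ge_zero[of "x' - x"]] by (simp add: mult.assoc)
      finally show ?thesis
        by (simp add: dist_norm norm_minus_commute)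
    qed
    then obtain x where "Ti (y - f x) = x"
      using banach_fix_type[of "1 / 2" "\<lambda>x. Ti (y - f x)"] by auto
    then have "T x = y - f x"
      by (metis T_Ti)
    then show ?thesis
      by (intro exI[of _ x]) simp
  qed
  then obtain Gi where Gi: "\<And>y. T (Gi y) + f (Gi y) = y"
    by metis
  have expand: "norm (x - x') \<le> 2 * B * norm ((T x + f x) - (T x' + f x'))" for x x'
  proof -
    let ?d = "(T x + f x) - (T x' + f x')"
    have "x - x' = Ti (?d - (f x - f x'))"
      by (simp add: Ti.diff Ti.add Ti_T)
    then have "norm (x - x') \<le> B * norm (?d - (f x - f x'))"
      using B(1) by metis
    also have "\<dots> \<le> B * (norm ?d + \<epsilon> * norm (x - x'))"
      using f[of x x'] by (intro mult_left_mono B(2) order_trans[OF norm_triangle_ineq4]) auto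
    also have "\<dots> \<le> B * norm ?d + 1 / 2 * norm (x - x')"
      using mult_right_mono[OF B(3) norm_ge_zero[of "x - x'"]] by (simp add: algebra_simps)
    finally show ?thesis
      by simp
  qed
  show thesis
  proof (rule that[of Gi])
    show "Gi (T x + f x) = x" for x
      using expand[of "Gi (T x + f x)" x] by (simp add: Gi)
    show "norm (Gi y - Gi y') \<le> 2 * B * norm (y - y')" for y y'
      using expand[of "Gi y" "Gi y'"] by (simp add: Gi)
  qed (rule Gi)
qed

text \<open>
The retraction onto the closed ball of radius \<open>\<delta>\<close>. In a general Banach space there need not be smooth cut-off
functions; a Lipschitz retraction is enough here.
\<close>
definition radial_retraction :: "real \<Rightarrow> 'a::real_normed_vector \<Rightarrow> 'a" where
  "radial_retraction \<delta> x = (\<delta> / max \<delta> (norm x)) *\<^sub>R x"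

lemma radial_retraction_id: "\<delta> > 0 \<Longrightarrow> norm x \<le> \<delta> \<Longrightarrow> radial_retraction \<delta> x = x"
  by (simp add: radial_retraction_def)

lemma norm_radial_retraction:
  assumes "\<delta> > 0"
  shows "norm (radial_retraction \<delta> x) \<le> \<delta>"
proof -
  have "norm (radial_retraction \<delta> x) = \<delta> * (norm x / max \<delta> (norm x))"
    using assms by (simp add: radial_retraction_def)
  also have "\<dots> \<le> \<delta> * 1"
    using assms by (intro mult_left_mono) (auto simp: divide_le_eq_1)
  finally show ?thesis
    by simp
qed

text \<open>
The constant \<open>2\<close> arises from moving first the point and then the scaling factor.
\<close>
lemma radial_retraction_lipschitz:
  assumes "\<delta> > 0"
  shows "norm (radial_retraction \<delta> x - radial_retraction \<delta> y) \<le> 2 * norm (x - y)"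
proof -
  define a b where "a = max \<delta> (norm x)" and "b = max \<delta> (norm y)"
  have ab: "a \<ge> \<delta>" "b \<ge> \<delta>" "a > 0" "b > 0" "norm y \<le> b"
    using assms by (auto simp: a_def b_def)
  have "\<bar>b - a\<bar> \<le> norm (x - y)"
    using norm_triangle_ineq3[of x y] by (auto simp: a_def b_def max_def)
  have "\<delta> / a - \<delta> / b = (\<delta> / a) * ((b - a) / b)"
    using ab by (simp add: field_simps)
  moreover have "(\<delta> / a) *\<^sub>R x - (\<delta> / b) *\<^sub>R y = (\<delta> / a) *\<^sub>R (x - y) + (\<delta> / a - \<delta> / b) *\<^sub>R y"
    by (simp add: algebra_simps)
  ultimately have "radial_retraction \<delta> x - radial_retraction \<delta> y = (\<delta> / a) *\<^sub>R ((x - y) + ((b - a) / b) *\<^sub>R y)"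
    unfolding radial_retraction_def a_def[symmetric] b_def[symmetric] by (simp add: scaleR_add_right)
  then have "norm (radial_retraction \<delta> x - radial_retraction \<delta> y) = (\<delta> / a) * norm ((x - y) + ((b - a) / b) *\<^sub>R y)"
    using ab assms by simp
  also have "\<dots> \<le> 1 * (norm (x - y) + norm (x - y))"
  proof (intro mult_mono order_trans[OF norm_triangle_ineq] add_left_mono)
    have "norm (((b - a) / b) *\<^sub>R y) = \<bar>b - a\<bar> * (norm y / b)"
      using ab by simp
    also have "\<dots> \<le> norm (x - y) * 1"
      using \<open>\<bar>b - a\<bar> \<le> norm (x - y)\<close> ab by (intro mult_mono) auto
    finally show "norm (((b - a) / b) *\<^sub>R y) \<le> norm (x - y)"
      by simp
  qed (use ab assms in auto)
  finally show ?thesis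
    by simp
qed

lemma le_two_powr:
  fixes t :: real
  assumes "0 \<le> t" "t \<le> 2" "0 < \<theta>" "\<theta> \<le> 1"
  shows "t \<le> 2 * t powr \<theta>"
proof -
  have "t / 2 \<le> (t / 2) powr \<theta>"
    using powr_mono'[of \<theta> 1 "t / 2"] assms by simp
  also have "\<dots> \<le> t powr \<theta>"
    using assms by (intro powr_mono2) auto
  finally show ?thesis
    by simp
qed

text \<open>
Outside the bounded set \<open>U\<close> the identity is not Hoelder with an exponent below \<open>1\<close>, so that only the
corrections \<open>H - id\<close> and \<open>K - id\<close> are controlled globally. On a set of diameter at most \<open>1\<close>, whose image
has diameter at most \<open>2\<close>, the identity contributes a factor of at most \<open>2\<close>.
\<close>
lemma holder_homeomorphism_of_holder_corrections:
  fixes H K :: "'a::real_normed_vector \<Rightarrow> 'a"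
  assumes \<theta>: "0 < \<theta>" "\<theta> \<le> 1" and HK: "\<And>x. H (K x) = x" and KH: "\<And>x. K (H x) = x"
    and H: "\<And>x y. norm ((H x - x) - (H y - y)) \<le> norm (x - y) powr \<theta>"
    and K: "\<And>x y. norm ((K x - x) - (K y - y)) \<le> norm (x - y) powr \<theta>"
    and U: "open U" "\<And>x y. x \<in> U \<Longrightarrow> y \<in> U \<Longrightarrow> norm (x - y) \<le> 1"
  shows "homeomorphism UNIV UNIV H K" "holder_homeomorphism \<theta> U (H ` U) H"
proof -
  have cont: "continuous_on UNIV L"
    if "\<And>x y. norm ((L x - x) - (L y - y)) \<le> norm (x - y) powr \<theta>" for L :: "'a \<Rightarrow> 'a"
  proof -
    have "continuous_on UNIV (\<lambda>x. L x - x)"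
      using that \<theta> by (intro continuous_on_of_holder[where c = 1]) auto
    then have "continuous_on UNIV (\<lambda>x. (L x - x) + x)"
      by (rule continuous_on_add[OF _ continuous_on_id])
    then show ?thesis
      by simp
  qed
  show hom: "homeomorphism UNIV UNIV H K"
    using HK KH by (intro homeomorphismI cont H K) auto
  have inj: "inj_on H U"
    by (metis KH inj_onI)
  have inv: "inv_into U H y = K y" if "y \<in> H ` U" for y
    using that KH inj by auto
  have est: "norm (L x - L y) \<le> norm (x - y) + norm (x - y) powr \<theta>"
    if "\<And>x y. norm ((L x - x) - (L y - y)) \<le> norm (x - y) powr \<theta>" for L :: "'a \<Rightarrow> 'a" and x y
    using that[of x y] norm_triangle_ineq[of "x - y" "(L x - x) - (L y - y)"] by (simp add: algebra_simps)
  have est3: "norm (L x - L y) \<le> 3 * norm (x - y) powr \<theta>"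
    if "\<And>x y. norm ((L x - x) - (L y - y)) \<le> norm (x - y) powr \<theta>" "norm (x - y) \<le> 2"
    for L :: "'a \<Rightarrow> 'a" and x y
    using est[of L x y] that le_two_powr[of "norm (x - y)" \<theta>] \<theta> by fastforce
  have "open (K -` U)"
    using U(1) cont[OF K] by (simp add: open_vimage)
  moreover have "H ` U = K -` U"
    using HK KH by (auto simp: image_iff) metis
  ultimately have "open (H ` U)"
    by simp
  have "homeomorphism U (H ` U) H K"
    using homeomorphism_of_subsets[OF hom, of U "H ` U"] by simp
  then have "homeomorphism U (H ` U) H (inv_into U H)"
    by (rule homeomorphism_cong) (auto simp: inv inj)
  moreover have "norm (inv_into U H y - inv_into U H y') \<le> 3 * norm (y - y') powr \<theta>"
    if "y \<in> H ` U" "y' \<in> H ` U" for y y'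
  proof -
    from that obtain x x' where x: "x \<in> U" "x' \<in> U" "y = H x" "y' = H x'"
      by blast
    have "norm (x - x') powr \<theta> \<le> 1"
      using U(2)[OF x(1,2)] \<theta> by (intro powr_le1) auto
    then have "norm (y - y') \<le> 2"
      using est[of H x x', OF H] U(2)[OF x(1,2)] x by simp
    then show ?thesis
      using est3[of K y y', OF K] inv that by simp
  qed
  moreover have "norm (H x - H x') \<le> 3 * norm (x - x') powr \<theta>" if "x \<in> U" "x' \<in> U" for x x'
    using est3[of H x x', OF H] U(2)[OF that] by simp
  ultimately show "holder_homeomorphism \<theta> U (H ` U) H"
    unfolding holder_homeomorphism_def using U(1) \<open>open (H ` U)\<close>
    by (intro conjI exI[of _ "3 :: real"]) auto
qed

section \<open>Local linearization\<close>

context linear_splitting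
begin

text \<open>
The exponent bound \<open>\<theta>\<^sub>0\<close> depends only on the decay rate \<open>r\<close> and on the constant \<open>M\<close>, a Lipschitz constant of
\<open>T\<close>, \<open>G\<close> and their inverses that is fixed before the neighbourhood is chosen. For a given \<open>\<theta>\<close> the
perturbation is then made small by shrinking the neighbourhood.
\<close>
theorem local_linearization:
  fixes F :: "'a \<Rightarrow> 'a" and F' :: "'a \<Rightarrow> 'a \<Rightarrow>\<^sub>L 'a"
  assumes F': "\<And>x. (F has_derivative blinfun_apply (F' x)) (at x)" and cont: "continuous_on UNIV F'"
    and p: "F p = p" and T_eq: "T = blinfun_apply (F' p)"
  shows "\<exists>\<theta>\<^sub>0>0. \<forall>\<theta>. 0 < \<theta> \<and> \<theta> < \<theta>\<^sub>0 \<longrightarrow>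
    (\<exists>H U. (\<exists>H'. homeomorphism UNIV UNIV H H') \<and> open U \<and> p \<in> U \<and>
      (\<forall>x\<in>U. H (F x) = T (H x)) \<and> holder_homeomorphism \<theta> U (H ` U) H)"
proof -
  interpret T: bounded_linear T by (rule T)
  interpret Ti: bounded_linear Ti by (rule Ti)
  obtain A where A: "A > 0" "\<And>x. norm (T x) \<le> norm x * A"
    using T.pos_bounded by blast
  obtain B where B: "B > 0" "\<And>x. norm (Ti x) \<le> norm x * B"
    using Ti.pos_bounded by blast
  \<comment> \<open>\<open>A + 1\<close> bounds the Lipschitz constant of \<open>G\<close> since \<open>f\<close> has constant at most \<open>1\<close>, and \<open>2 * B\<close> that of
    the inverse of \<open>G\<close>.\<close>
  define M where "M = A + 1 + 2 * B"
  have M: "M > 1"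
    using A B by (simp add: M_def)
  \<comment> \<open>Below this value, \<open>r * M powr \<theta> < 1\<close>.\<close>
  define \<theta>\<^sub>0 where "\<theta>\<^sub>0 = min 1 (- ln r / ln M)"
  have "\<theta>\<^sub>0 > 0"
    using M r_pos r_less_1 divide_neg_pos[of "ln r" "ln M"] by (simp add: \<theta>\<^sub>0_def)
  moreover have "\<exists>H U. (\<exists>H'. homeomorphism UNIV UNIV H H') \<and> open U \<and> p \<in> U \<and>
      (\<forall>x\<in>U. H (F x) = T (H x)) \<and> holder_homeomorphism \<theta> U (H ` U) H"
    if \<theta>: "0 < \<theta>" "\<theta> < \<theta>\<^sub>0" for \<theta>
  proof -
    have "\<theta> \<le> 1" "\<theta> < - ln r / ln M"
      using \<theta> by (auto simp: \<theta>\<^sub>0_def)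
    then have "\<theta> * ln M < - ln r"
      using M pos_less_divide_eq[of "ln M" \<theta> "- ln r"] by simp
    then have "ln (r * M powr \<theta>) < 0"
      using M r_pos by (simp add: ln_mult ln_powr)
    then have contr: "r * M powr \<theta> < 1"
      using M r_pos by (simp add: ln_less_zero_iff)
    define \<Lambda> where "\<Lambda> = 2 * C * M powr \<theta> / (1 - r * M powr \<theta>)"
    have "\<Lambda> \<ge> 0"
      using contr C_nonneg by (simp add: \<Lambda>_def)
    define \<epsilon> where "\<epsilon> = 1 / (2 * (\<Lambda> + B + 1))"
    have \<epsilon>: "\<epsilon> > 0" "\<Lambda> * \<epsilon> \<le> 1 / 2" "B * \<epsilon> \<le> 1 / 2" "\<epsilon> \<le> 1"
      using \<open>\<Lambda> \<ge> 0\<close> B by (auto simp: \<epsilon>_def field_simps add_pos_nonneg)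
    obtain d where d: "d > 0" "\<And>x. dist x p < d \<Longrightarrow> dist (F' x) (F' p) < \<epsilon> / 2"
      using cont \<epsilon>(1) unfolding continuous_on_iff by (metis UNIV_I half_gt_zero)
    \<comment> \<open>The radius is at most \<open>1 / 2\<close> so that \<open>f\<close> is bounded by \<open>\<epsilon> / 2\<close> and the ball has diameter at most \<open>1\<close>.\<close>
    define \<delta> where "\<delta> = min (d / 2) (1 / 2)"
    have \<delta>: "\<delta> > 0" "\<delta> < d" "\<delta> \<le> 1 / 2"
      using d by (auto simp: \<delta>_def)
    define g where "g v = F (p + v) - p - T v" for v
    have g_deriv: "(g has_derivative (F' (p + v) - F' p)) (at v within cball 0 \<delta>)" for v
    proof -
      have "((\<lambda>v. p + v) has_derivative (\<lambda>v. v)) (at v within cball 0 \<delta>)"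
        by (auto intro!: derivative_eq_intros)
      then have "((\<lambda>v. F (p + v)) has_derivative F' (p + v)) (at v within cball 0 \<delta>)"
        by (rule has_derivative_compose) (rule F')
      then have "((\<lambda>v. F (p + v) - p - T v) has_derivative (\<lambda>w. F' (p + v) w - 0 - T w)) (at v within cball 0 \<delta>)"
        by (intro has_derivative_diff has_derivative_const bounded_linear_imp_has_derivative T)
      then show ?thesis
        unfolding g_def[abs_def] by (simp add: T_eq blinfun.diff_left[abs_def] fun_eq_iff)
    qed
    have g: "norm (g v - g w) \<le> \<epsilon> / 2 * norm (v - w)" if "norm v \<le> \<delta>" "norm w \<le> \<delta>" for v w
    proof (rule differentiable_bound[of "cball 0 \<delta>", OF _ g_deriv])
      fix u :: 'a
      assume "u \<in> cball 0 \<delta>"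
      then have "dist (F' (p + u)) (F' p) < \<epsilon> / 2"
        using \<delta> by (intro d) (simp add: dist_norm)
      then show "onorm (blinfun_apply (F' (p + u) - F' p)) \<le> \<epsilon> / 2"
        by (simp add: dist_norm norm_blinfun.rep_eq)
    qed (use that in auto)
    define f where "f v = g (radial_retraction \<delta> v)" for v
    have f_lipschitz: "norm (f v - f w) \<le> \<epsilon> * norm (v - w)" for v w
    proof -
      have "norm (f v - f w) \<le> \<epsilon> / 2 * norm (radial_retraction \<delta> v - radial_retraction \<delta> w)"
        unfolding f_def by (intro g norm_radial_retraction \<delta>)
      also have "\<dots> \<le> \<epsilon> / 2 * (2 * norm (v - w))"
        using \<epsilon> by (intro mult_left_mono radial_retraction_lipschitz \<delta>) auto
      finally show ?thesis
        by simp
    qed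
    have f_bound: "norm (f v) \<le> \<epsilon> / 2" for v
    proof -
      have "norm (f v) \<le> \<epsilon> / 2 * norm (radial_retraction \<delta> v)"
        using g[of "radial_retraction \<delta> v" 0] norm_radial_retraction[of \<delta> v] \<delta>
        by (simp add: f_def g_def[of 0] p T.zero)
      also have "\<dots> \<le> \<epsilon> / 2 * 1"
        using norm_radial_retraction[of \<delta> v] \<delta> \<epsilon> by (intro mult_left_mono) auto
      finally show ?thesis
        by simp
    qed
    define G where "G v = T v + f v" for v
    obtain Gi where Gi: "\<And>x. Gi (G x) = x" "\<And>y. G (Gi y) = y"
      "\<And>y y'. norm (Gi y - Gi y') \<le> 2 * B * norm (y - y')"
      using lipschitz_perturbation_inverse[OF T Ti T_Ti Ti_T f_lipschitz, of B] B \<epsilon>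
      unfolding G_def by (metis less_imp_le mult.commute)
    interpret perturbed_splitting T Ti P Q C r f G Gi \<epsilon> M \<theta>
    proof
      fix x y :: 'a
      have le: "c * norm (x - y) \<le> M * norm (x - y)" if "c \<le> M" for c
        using that by (intro mult_right_mono) auto
      have T_le: "norm (T x - T y) \<le> A * norm (x - y)"
        using A(2)[of "x - y"] by (simp add: T.diff mult.commute)
      then show "norm (T x - T y) \<le> M * norm (x - y)"
        using le[of A] B by (simp add: M_def)
      have "norm (Ti x - Ti y) \<le> B * norm (x - y)"
        using B(2)[of "x - y"] by (simp add: Ti.diff mult.commute)
      then show "norm (Ti x - Ti y) \<le> M * norm (x - y)"
        using le[of B] A B by (simp add: M_def)
      have "norm (G x - G y) \<le> norm (T x - T y) + norm (f x - f y)"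
        unfolding G_def using norm_triangle_ineq[of "T x - T y" "f x - f y"] by (simp add: algebra_simps)
      also have "\<dots> \<le> (A + \<epsilon>) * norm (x - y)"
        using T_le f_lipschitz[of x y] by (simp add: distrib_right)
      also have "\<dots> \<le> M * norm (x - y)"
        using \<epsilon> B by (intro le) (simp add: M_def)
      finally show "norm (G x - G y) \<le> M * norm (x - y)" .
      show "norm (Gi x - Gi y) \<le> M * norm (x - y)"
        using Gi(3)[of x y] le[of "2 * B"] A by (simp add: M_def)
    qed (use f_lipschitz f_bound Gi M \<theta> \<open>\<theta> \<le> 1\<close> contr \<epsilon>(2) in \<open>auto simp: G_def \<Lambda>_def\<close>)
    obtain H K where "\<forall>x. H (K x) = x" "\<forall>x. K (H x) = x" "\<forall>x. H (G x) = T (H x)"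
      "\<forall>x y. norm ((H x - x) - (H y - y)) \<le> norm (x - y) powr \<theta>"
      "\<forall>x y. norm ((K x - x) - (K y - y)) \<le> norm (x - y) powr \<theta>"
      using conjugacy_exists by (elim exE conjE) (rule that; assumption)
    note HK = this(1,2)[rule_format] and H_G = this(3)[rule_format]
      and H = this(4)[rule_format] and K = this(5)[rule_format]
    define Hp where "Hp x = H (x - p)" for x
    define Kp where "Kp y = K y + p" for y
    have diam: "norm (x - y) \<le> 1" if "x \<in> ball p \<delta>" "y \<in> ball p \<delta>" for x y
    proof -
      have "dist x y \<le> dist x p + dist y p"
        by (rule dist_triangle2)
      then show ?thesis
        using that \<delta> by (simp add: dist_commute dist_norm[symmetric])
    qed
    have F_near: "F x - p = G (x - p)" if "x \<in> ball p \<delta>" for x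
      using that by (simp add: G_def f_def g_def radial_retraction_id[OF \<delta>(1)] dist_norm norm_minus_commute)
    have corrections: "norm ((Hp x - x) - (Hp y - y)) \<le> norm (x - y) powr \<theta>"
      "norm ((Kp x - x) - (Kp y - y)) \<le> norm (x - y) powr \<theta>" for x y
      using H[of "x - p" "y - p"] K[of x y] by (simp_all add: Hp_def Kp_def algebra_simps)
    have inverse: "Hp (Kp x) = x" "Kp (Hp x) = x" for x
      by (simp_all add: Hp_def Kp_def HK)
    note hom = holder_homeomorphism_of_holder_corrections
      [OF \<theta>(1) \<open>\<theta> \<le> 1\<close> inverse corrections open_ball diam]
    have "\<forall>x\<in>ball p \<delta>. Hp (F x) = T (Hp x)"
      by (simp add: Hp_def F_near H_G)
    with hom show ?thesis
      using \<delta>(1) by (intro exI[of _ Hp] exI[of _ "ball p \<delta>"] conjI exI[of _ Kp]) auto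
  qed
  ultimately show ?thesis
    by blast
qed

end

section \<open>The splitting of a generalized hyperbolic operator\<close>

lemma linear_splittingI:
  fixes T P :: "'a::banach \<Rightarrow> 'a"
  assumes T: "bounded_linear T" "bij T" "bounded_linear (inv T)" and P: "bounded_linear P"
    and decay_P: "\<exists>C r. 0 < r \<and> r < 1 \<and> (\<forall>n x. norm ((T ^^ n) (P x)) \<le> C * r ^ n * norm x)"
    and decay_Q: "\<exists>C r. 0 < r \<and> r < 1 \<and> (\<forall>n x. norm ((inv T ^^ n) (x - P x)) \<le> C * r ^ n * norm x)"
  shows "\<exists>C r. linear_splitting T (inv T) P (\<lambda>x. x - P x) C r"
proof -
  obtain C1 r1 where 1: "0 < r1" "r1 < 1" "\<And>n x. norm ((T ^^ n) (P x)) \<le> C1 * r1 ^ n * norm x"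
    using decay_P by blast
  obtain C2 r2 where 2: "0 < r2" "r2 < 1" "\<And>n x. norm ((inv T ^^ n) (x - P x)) \<le> C2 * r2 ^ n * norm x"
    using decay_Q by blast
  define C r where "C = max 0 (max C1 C2)" and "r = max r1 r2"
  have mono: "c * q ^ n * norm x \<le> C * r ^ n * norm x"
    if "c \<le> C" "0 < q" "q \<le> r" for c q :: real and n and x :: 'a
  proof -
    have "c * q ^ n \<le> C * r ^ n"
      using that by (intro mult_mono power_mono) (auto simp: C_def)
    then show ?thesis
      by (rule mult_right_mono) simp
  qed
  have "linear_splitting T (inv T) P (\<lambda>x. x - P x) C r"
  proof (rule linear_splitting.intro)
    show "norm ((T ^^ n) (P x)) \<le> C * r ^ n * norm x" for n x
      using 1(1) by (intro order_trans[OF 1(3) mono]) (auto simp: C_def r_def)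
    show "norm ((inv T ^^ n) (x - P x)) \<le> C * r ^ n * norm x" for n x
      using 2(1) by (intro order_trans[OF 2(3) mono]) (auto simp: C_def r_def)
    show "bounded_linear (\<lambda>x. x - P x)"
      by (intro bounded_linear_sub bounded_linear_ident P)
    show "T (inv T x) = x" "inv T (T x) = x" for x
      using T(2) by (simp_all add: bij_is_surj surj_f_inv_f bij_is_inj)
  qed (use T P 1 2 in \<open>auto simp: C_def r_def\<close>)
  then show ?thesis
    by blast
qed

lemma real_hyperbolic_splitting:
  fixes T :: "'a::banach \<Rightarrow> 'a"
  assumes "generalized_hyperbolic scaleR real_spectrum_on T"
  shows "\<exists>P Q C r. linear_splitting T (inv T) P Q C r"
proof -
  from assms obtain Em Ep where T: "bounded_linear T" "bij T" "bounded_linear (inv T)"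
    and E: "subspace Em" "closed Em" "subspace Ep" "closed Ep" "Em \<inter> Ep = {0}"
      "\<forall>x. \<exists>u\<in>Em. \<exists>v\<in>Ep. x = u + v"
    and inv: "T ` Ep \<subseteq> Ep" "inv T ` Em \<subseteq> Em"
    and spec: "real_spectrum_on Ep T \<subseteq> ball 0 1" "real_spectrum_on Em (inv T) \<subseteq> ball 0 1"
    unfolding generalized_hyperbolic_def subspace_raw_def[symmetric]
    by (elim conjE exE) (rule that; assumption)
  obtain P where P: "bounded_linear P" "\<And>x. P x \<in> Ep" "\<And>x. x - P x \<in> Em"
    "\<And>u v. u \<in> Em \<Longrightarrow> v \<in> Ep \<Longrightarrow> P (u + v) = v"
    using projection_of_closed_splitting[OF E(1-5)] E(6) by blast
  have P_Ep: "P x = x" if "x \<in> Ep" for x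
    using P(4)[of 0 x] that subspace_0[OF E(1)] by simp
  have P_Em: "x - P x = x" if "x \<in> Em" for x
    using P(4)[of x 0] that subspace_0[OF E(3)] by simp
  have Q: "bounded_linear (\<lambda>x. x - P x)"
    by (intro bounded_linear_sub bounded_linear_ident P(1))
  show ?thesis
    using linear_splittingI[OF T P(1)
        real_spectrum_in_disc_imp_exponential_decay[OF P(1,2) P_Ep T(1) inv(1) spec(1)]
        real_spectrum_in_disc_imp_exponential_decay[OF Q P(3) P_Em T(3) inv(2) spec(2)]]
    by blast
qed

lemma complex_hyperbolic_splitting:
  fixes T :: "'a::banach \<Rightarrow> 'a"
  assumes "complex_banach_space s" "generalized_hyperbolic s (spectrum_on s) T"
  shows "\<exists>P Q C r. linear_splitting T (inv T) P Q C r"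
proof -
  interpret complex_banach_space s by fact
  from assms(2) obtain Em Ep
    where T: "bounded_linear T" "Vector_Spaces.linear s s T" "bij T" "bounded_linear (inv T)"
    and E: "module.subspace s Em" "closed Em" "module.subspace s Ep" "closed Ep" "Em \<inter> Ep = {0}"
      "\<forall>x. \<exists>u\<in>Em. \<exists>v\<in>Ep. x = u + v"
    and inv: "T ` Ep \<subseteq> Ep" "inv T ` Em \<subseteq> Em"
    and spec: "spectrum_on s Ep T \<subseteq> ball 0 1" "spectrum_on s Em (inv T) \<subseteq> ball 0 1"
    unfolding generalized_hyperbolic_def by (elim conjE exE) (rule that; assumption)
  have real_subspace: "real_vector.subspace V" if "module.subspace s V" for V
    using that unfolding subspace_def real_vector.subspace_def by (metis scaleC_of_real)
  obtain P where P: "bounded_linear P" "\<And>x. P x \<in> Ep" "\<And>x. x - P x \<in> Em"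
    "\<And>u v. u \<in> Em \<Longrightarrow> v \<in> Ep \<Longrightarrow> P (u + v) = v"
    using projection_of_closed_splitting[OF real_subspace[OF E(1)] E(2) real_subspace[OF E(3)] E(4,5)] E(6)
    by blast
  have P_Ep: "P x = x" if "x \<in> Ep" for x
    using P(4)[of 0 x] that subspace_0[OF E(1)] by simp
  have P_Em: "x - P x = x" if "x \<in> Em" for x
    using P(4)[of x 0] that subspace_0[OF E(3)] by simp
  have Q: "bounded_linear (\<lambda>x. x - P x)"
    by (intro bounded_linear_sub bounded_linear_ident P(1))
  have P_s: "P (s z x) = s z (P x)" for z x
    using P(4)[OF subspace_scale[OF E(1) P(3)] subspace_scale[OF E(3) P(2)], of z x z x]
    by (simp add: scale_right_diff_distrib)
  then have Q_s: "s z x - P (s z x) = s z (x - P x)" for z x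
    by (simp add: scale_right_diff_distrib)
  have T_s: "T (s z x) = s z (T x)" for z x
  proof -
    interpret T: Vector_Spaces.linear s s T by (rule T(2))
    show ?thesis
      by (rule T.scale)
  qed
  then have Ti_s: "inv T (s z x) = s z (inv T x)" for z x
    using T(3) by (metis bij_inv_eq_iff)
  note decay = spectrum_in_disc_imp_exponential_decay[where s = s and K = 1, OF vector_space_axioms scaleC_of_real]
  have norm: "norm (s z x) \<le> 1 * cmod z * norm x" for z x
    by (simp add: norm_scaleC)
  show ?thesis
    using linear_splittingI[OF T(1,3,4) P(1)
        decay[OF norm _ P(1) P_s P(2) P_Ep T(1) T_s inv(1) spec(1)]
        decay[OF norm _ Q Q_s P(3) P_Em T(4) Ti_s inv(2) spec(2)]]
    by auto
qed

section \<open>Generalized hyperbolic fixed points\<close>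

theorem theorem3:
  fixes F :: "'a::banach \<Rightarrow> 'a" and p :: 'a and scaleC :: "complex \<Rightarrow> 'a \<Rightarrow> 'a"
  assumes real_or_complex:
    "(C1_diffeomorphism scaleR F \<and>
      generalized_hyperbolic_fixed_point scaleR real_spectrum_on F p) \<or>
     (complex_banach_space scaleC \<and> C1_diffeomorphism scaleC F \<and>
      generalized_hyperbolic_fixed_point scaleC (spectrum_on scaleC) F p)"
  shows
    "(\<exists>H U. (\<exists>H'. homeomorphism UNIV UNIV H H') \<and> open U \<and> p \<in> U \<and>
        (\<forall>x\<in>U. H (F x) = frechet_derivative F (at p) (H x))) \<and>
     (\<exists>\<theta>\<^sub>0>0. \<forall>\<theta>. 0 < \<theta> \<and> \<theta> < \<theta>\<^sub>0 \<longrightarrow>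
        (\<exists>H U. (\<exists>H'. homeomorphism UNIV UNIV H H') \<and> open U \<and> p \<in> U \<and>
           (\<forall>x\<in>U. H (F x) = frechet_derivative F (at p) (H x)) \<and>
           holder_homeomorphism \<theta> U (H ` U) H))"
proof -
  define T where "T = frechet_derivative F (at p)"
  obtain F' :: "'a \<Rightarrow> 'a \<Rightarrow>\<^sub>L 'a" where F': "\<And>x. (F has_derivative blinfun_apply (F' x)) (at x)"
    and cont: "continuous_on UNIV F'"
    using real_or_complex unfolding C1_diffeomorphism_def C1_map_def by blast
  have "F p = p"
    using real_or_complex unfolding generalized_hyperbolic_fixed_point_def by blast
  have "T = blinfun_apply (F' p)"
    unfolding T_def using frechet_derivative_at[OF F'] by simp
  have "\<exists>P Q C r. linear_splitting T (inv T) P Q C r"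
    using real_or_complex real_hyperbolic_splitting complex_hyperbolic_splitting
    unfolding T_def generalized_hyperbolic_fixed_point_def by blast
  then obtain P Q C r where "linear_splitting T (inv T) P Q C r"
    by blast
  then have *: "\<exists>\<theta>\<^sub>0>0. \<forall>\<theta>. 0 < \<theta> \<and> \<theta> < \<theta>\<^sub>0 \<longrightarrow>
    (\<exists>H U. (\<exists>H'. homeomorphism UNIV UNIV H H') \<and> open U \<and> p \<in> U \<and>
      (\<forall>x\<in>U. H (F x) = T (H x)) \<and> holder_homeomorphism \<theta> U (H ` U) H)"
    by (rule linear_splitting.local_linearization) (fact F' cont \<open>F p = p\<close> \<open>T = blinfun_apply (F' p)\<close>)+
  then obtain \<theta>\<^sub>0 :: real where "\<theta>\<^sub>0 > 0" and "\<forall>\<theta>. 0 < \<theta> \<and> \<theta> < \<theta>\<^sub>0 \<longrightarrow>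
    (\<exists>H U. (\<exists>H'. homeomorphism UNIV UNIV H H') \<and> open U \<and> p \<in> U \<and>
      (\<forall>x\<in>U. H (F x) = T (H x)) \<and> holder_homeomorphism \<theta> U (H ` U) H)"
    by blast
  moreover have "0 < \<theta>\<^sub>0 / 2 \<and> \<theta>\<^sub>0 / 2 < \<theta>\<^sub>0"
    using \<open>\<theta>\<^sub>0 > 0\<close> by simp
  ultimately have "\<exists>H U. (\<exists>H'. homeomorphism UNIV UNIV H H') \<and> open U \<and> p \<in> U \<and> (\<forall>x\<in>U. H (F x) = T (H x))"
    by meson
  with * show ?thesis
    unfolding T_def by blast
qed

end
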